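(* Let $\mathcal B$ be a separable Hilbert space with inner product $\langle u_1,u_2\rangle:=[Q^{-1}u_1,u_2]$, where $Q:\mathcal B^*\to\mathcal B$ is a continuous (symmetric, positive) linear bijection and $[\cdot,\cdot]$ is the dual pairing. Let $\phi_1,\dots,\phi_m\in\mathcal B^*$ be linearly independent with span $\Phi$, and suppose $\dim(\Phi)<\dim(\mathcal B)$. Let $P_{Q\Phi}$ be the orthogonal projection of $\mathcal B$ onto $Q\Phi$, let $\Phi^\perp(Q)$ be the short of $Q$ and $\mu_{\Phi^\perp(Q)}$ the corresponding Gaussian (cylinder) measure. Then the pair $$(P_{Q\Phi},\ \mu_{\Phi^\perp(Q)})$$ is a saddle point of $\Psi$. Moreover, when $\mathcal B$ is infinite dimensional, the approximating sequence in the definition of saddle point can be chosen to be a sequence of (countably additive) Gaussian probability measures on $\mathcal B$.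
   Context: $L(\Phi,\mathcal B)$ is the set of functions $v:\mathcal B\to\mathcal B$ measurable from the $\sigma$-algebra generated by $\phi_1,\dots,\phi_m$ to the Borel $\sigma$-algebra. $\mathcal M_2(\mathcal B)$ is the set of Borel probability measures on $\mathcal B$ with finite, nonzero second moment, and $\Psi(v,\mu):=\int\|x-v(x)\|^2d\mu(x)\big/\int\|x\|^2d\mu(x)$ for $v\in L(\Phi,\mathcal B)$, $\mu\in\mathcal M_2(\mathcal B)$. A cylinder measure on $\mathcal B$ is a finitely additive set function on the cylinder sets whose push-forward $F_*\mu$ by every continuous linear map $F$ to a finite-dimensional space is a probability measure. $CM$ is the set of cylinder measures, with the weak cylinder measure topology: $\mu_n\to\mu$ iff $F_*\mu_n\to F_*\mu$ weakly for every continuous linear finite-rank projection $F$ on $\mathcal B$. $(v^*,\mu^* )\in L(\Phi,\mathcal B)\times\mathcal M_2(\mathcal B)$ is an $\epsilon$-saddle point of $\Psi$ if $\Psi(v^*,\mu)-\epsilon\le\Psi(v^*,\mu^* )\le\Psi(v,\mu^* )+\epsilon$ for all $v\in L(\Phi,\mathcal B)$ and $\mu\in\mathcal M_2(\mathcal B)$. A pair $(v^*,\mu^* )\in L(\Phi,\mathcal B)\times CM$ is a saddle point of $\Psi$ if there is a sequence $\mu^*_n\in\mathcal M_2(\mathcal B)$ converging to $\mu^*$ in the weak cylinder measure topology such that $(v^*,\mu^*_n)$ is a $\frac1n$-saddle point of $\Psi$ for all $n$. The short $\Phi^\perp(Q):\mathcal B^*\to\mathcal B$ is the symmetric operator with $[s,\Phi^\perp(Q)s]=\inf\{[s+t,Q(s+t)]:t\in\Phi\}$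 for $s\in\mathcal B^*$. The Gaussian cylinder measure $\mu_T$ with covariance $T:\mathcal B^*\to\mathcal B$ is the cylinder measure under which each $\varphi\in\mathcal B^*$ has law $\mathcal N(0,[\varphi,T\varphi])$. *)

theory Defs
  imports "HOL-Probability.Probability"
begin

type_synonym 'a dual = "'a \<Rightarrow>\<^sub>L real"

text \<open>The dual pairing \<open>[f, x]\<close> is \<open>blinfun_apply f x\<close>; operators from the dual of \<open>'a\<close> into \<open>'a\<close>
  have type \<open>'a dual \<Rightarrow>\<^sub>L 'a\<close>.\<close>

definition symmetric_op :: "('a::real_normed_vector dual \<Rightarrow>\<^sub>L 'a) \<Rightarrow> bool" where
  "symmetric_op T \<longleftrightarrow>
     (\<forall>f g. blinfun_apply f (blinfun_apply T g) = blinfun_apply g (blinfun_apply T f))"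

definition positive_op :: "('a::real_normed_vector dual \<Rightarrow>\<^sub>L 'a) \<Rightarrow> bool" where
  "positive_op T \<longleftrightarrow> (\<forall>f. 0 \<le> blinfun_apply f (blinfun_apply T f))"

definition finite_dim :: "'a::real_vector set \<Rightarrow> bool" where
  "finite_dim S \<longleftrightarrow> (\<exists>B. finite B \<and> S \<subseteq> span B)"

definition orth_proj :: "'a::real_inner set \<Rightarrow> 'a \<Rightarrow> 'a" where
  "orth_proj S x = (THE y. y \<in> S \<and> (\<forall>z\<in>S. orthogonal (x - y) z))"


subsection \<open>The game\<close>

text \<open>In \<open>recovery_maps G\<close>, \<open>G\<close> is the set of the functionals that generate the
  \<open>\<sigma>\<close>-algebra.\<close>

definition recovery_maps :: "'a::real_normed_vector dual set \<Rightarrow> ('a \<Rightarrow> 'a) set" where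
  "recovery_maps G =
     sigma UNIV {blinfun_apply f -` A | f A. f \<in> G \<and> A \<in> sets borel} \<rightarrow>\<^sub>M borel"

definition M2 :: "'a::real_normed_vector measure set" where
  "M2 = {\<mu>. sets \<mu> = sets borel \<and> prob_space \<mu> \<and>
          (\<integral>\<^sup>+x. ennreal ((norm x)\<^sup>2) \<partial>\<mu>) < \<infinity> \<and> (\<integral>\<^sup>+x. ennreal ((norm x)\<^sup>2) \<partial>\<mu>) \<noteq> 0}"

text \<open>The numerator is infinite when \<open>v\<close> is not square integrable, so the loss is extended-real
  valued.\<close>

definition Psi :: "('a::real_normed_vector \<Rightarrow> 'a) \<Rightarrow> 'a measure \<Rightarrow> ereal" where
  "Psi v \<mu> = enn2ereal ((\<integral>\<^sup>+x. ennreal ((norm (x - v x))\<^sup>2) \<partial>\<mu>) /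
                       (\<integral>\<^sup>+x. ennreal ((norm x)\<^sup>2) \<partial>\<mu>))"

definition eps_saddle_point ::
  "'a::real_normed_vector dual set \<Rightarrow> real \<Rightarrow> ('a \<Rightarrow> 'a) \<Rightarrow> 'a measure \<Rightarrow> bool" where
  "eps_saddle_point G \<epsilon> v' \<mu>' \<longleftrightarrow>
     v' \<in> recovery_maps G \<and> \<mu>' \<in> M2 \<and>
     (\<forall>v\<in>recovery_maps G. \<forall>\<mu>\<in>M2.
        Psi v' \<mu> - ereal \<epsilon> \<le> Psi v' \<mu>' \<and> Psi v' \<mu>' \<le> Psi v \<mu>' + ereal \<epsilon>)"


subsection \<open>Cylinder measures\<close>

text \<open>Finite-dimensional target spaces are taken in coordinates: a continuous linear map into
  a \<open>k\<close>-dimensional space is a \<open>k\<close>-tuple of functionals, with values in the product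
  of \<open>k\<close> copies of the reals.\<close>

definition coord_map :: "nat \<Rightarrow> (nat \<Rightarrow> 'a::real_normed_vector dual) \<Rightarrow> 'a \<Rightarrow> nat \<Rightarrow> real" where
  "coord_map k f x = (\<lambda>i\<in>{..<k}. blinfun_apply (f i) x)"

abbreviation borel_power :: "nat \<Rightarrow> (nat \<Rightarrow> real) measure" where
  "borel_power k \<equiv> PiM {..<k} (\<lambda>_. borel)"

definition cylinder_sets :: "'a::real_normed_vector set set" where
  "cylinder_sets = {coord_map k f -` A | k f A. A \<in> sets (borel_power k)}"

text \<open>Only the \<open>\<sigma>\<close>-algebra of \<open>N\<close> matters in \<open>pushforward N F \<mu>\<close>. If the set function
  \<open>\<lambda>A. \<mu> (F -` A)\<close> is not countably additive on \<open>sets N\<close>, then \<open>measure_of\<close> returns the null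
  measure, which is not a probability measure.\<close>

definition pushforward :: "'b measure \<Rightarrow> ('a \<Rightarrow> 'b) \<Rightarrow> ('a set \<Rightarrow> ennreal) \<Rightarrow> 'b measure" where
  "pushforward N F \<mu> = measure_of (space N) (sets N) (\<lambda>A. \<mu> (F -` A))"

text \<open>A set function on the cylinder sets is represented by an extensional function, so that it
  carries no information outside of \<open>cylinder_sets\<close>.\<close>

definition CM :: "('a::real_normed_vector set \<Rightarrow> ennreal) set" where
  "CM = {\<mu>. \<mu> \<in> extensional cylinder_sets \<and> positive cylinder_sets \<mu> \<and> additive cylinder_sets \<mu> \<and>
          (\<forall>k f. prob_space (pushforward (borel_power k) (coord_map k f) \<mu>))}"

definition cylinder_of :: "'a::real_normed_vector measure \<Rightarrow> 'a set \<Rightarrow> ennreal" where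
  "cylinder_of \<mu> = restrict (emeasure \<mu>) cylinder_sets"

definition weakly_converges :: "(nat \<Rightarrow> 'a::topological_space measure) \<Rightarrow> 'a measure \<Rightarrow> bool" where
  "weakly_converges \<mu>s \<mu> \<longleftrightarrow>
     (\<forall>h::'a \<Rightarrow> real. continuous_on UNIV h \<and> bounded (range h) \<longrightarrow>
        (\<lambda>n. \<integral>x. h x \<partial>(\<mu>s n)) \<longlonglongrightarrow> (\<integral>x. h x \<partial>\<mu>))"

text \<open>The push-forward under a finite-rank projection \<open>F\<close> is a Borel measure on the whole space,
  concentrated on the closed subspace \<open>range F\<close>.\<close>

definition cylinder_converges ::
  "(nat \<Rightarrow> 'a::real_normed_vector set \<Rightarrow> ennreal) \<Rightarrow> ('a set \<Rightarrow> ennreal) \<Rightarrow> bool" where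
  "cylinder_converges \<mu>s \<mu> \<longleftrightarrow>
     (\<forall>F :: 'a \<Rightarrow>\<^sub>L 'a. F o\<^sub>L F = F \<and> finite_dim (range (blinfun_apply F)) \<longrightarrow>
        weakly_converges (\<lambda>n. pushforward borel (blinfun_apply F) (\<mu>s n))
                         (pushforward borel (blinfun_apply F) \<mu>))"


subsection \<open>Saddle points\<close>

definition approximating_sequence ::
  "'a::real_normed_vector dual set \<Rightarrow> ('a \<Rightarrow> 'a) \<Rightarrow> ('a set \<Rightarrow> ennreal) \<Rightarrow> (nat \<Rightarrow> 'a measure) \<Rightarrow> bool" where
  "approximating_sequence G v \<mu> \<mu>s \<longleftrightarrow>
     cylinder_converges (\<lambda>n. cylinder_of (\<mu>s n)) \<mu> \<and>
     (\<forall>n\<ge>1. \<mu>s n \<in> M2 \<and> eps_saddle_point G (1 / real n) v (\<mu>s n))"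

definition saddle_point ::
  "'a::real_normed_vector dual set \<Rightarrow> ('a \<Rightarrow> 'a) \<Rightarrow> ('a set \<Rightarrow> ennreal) \<Rightarrow> bool" where
  "saddle_point G v \<mu> \<longleftrightarrow>
     v \<in> recovery_maps G \<and> \<mu> \<in> CM \<and> (\<exists>\<mu>s. approximating_sequence G v \<mu> \<mu>s)"


subsection \<open>Shorts and Gaussian measures\<close>

definition is_short ::
  "('a::real_normed_vector dual \<Rightarrow>\<^sub>L 'a) \<Rightarrow> 'a dual set \<Rightarrow> ('a dual \<Rightarrow>\<^sub>L 'a) \<Rightarrow> bool" where
  "is_short Q \<Phi> T \<longleftrightarrow> symmetric_op T \<and>
     (\<forall>s. blinfun_apply s (blinfun_apply T s) =
           (INF t\<in>\<Phi>. blinfun_apply (s + t) (blinfun_apply Q (s + t))))"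

definition short :: "('a::real_normed_vector dual \<Rightarrow>\<^sub>L 'a) \<Rightarrow> 'a dual set \<Rightarrow> ('a dual \<Rightarrow>\<^sub>L 'a)" where
  "short Q \<Phi> = (THE T. is_short Q \<Phi> T)"

text \<open>\<open>normal_law m v\<close> is the normal law with mean \<open>m\<close> and variance \<open>v\<close>, a point mass when
  \<open>v = 0\<close>.\<close>

definition normal_law :: "real \<Rightarrow> real \<Rightarrow> real measure" where
  "normal_law m v =
     (if v = 0 then return borel m
      else density lborel (\<lambda>x. ennreal (normal_density m (sqrt v) x)))"

definition is_gaussian_cylinder_measure ::
  "('a::real_normed_vector dual \<Rightarrow>\<^sub>L 'a) \<Rightarrow> ('a set \<Rightarrow> ennreal) \<Rightarrow> bool" where
  "is_gaussian_cylinder_measure T \<mu> \<longleftrightarrow> \<mu> \<in> CM \<and>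
     (\<forall>f. pushforward borel (blinfun_apply f) \<mu> = normal_law 0 (blinfun_apply f (blinfun_apply T f)))"

definition gaussian_cylinder_measure ::
  "('a::real_normed_vector dual \<Rightarrow>\<^sub>L 'a) \<Rightarrow> 'a set \<Rightarrow> ennreal" where
  "gaussian_cylinder_measure T = (THE \<mu>. is_gaussian_cylinder_measure T \<mu>)"

definition gaussian_measure :: "'a::real_normed_vector measure \<Rightarrow> bool" where
  "gaussian_measure \<mu> \<longleftrightarrow> sets \<mu> = sets borel \<and> prob_space \<mu> \<and>
     (\<forall>f :: 'a dual. \<exists>m v. 0 \<le> v \<and> distr \<mu> borel (blinfun_apply f) = normal_law m v)"

end

(* The error of the projection P never exceeds that of the zero map, so Psi P is at most 1.
   Conversely let \<mu> be a centred Gaussian law carried by the orthogonal complement of Q \<Phi>. There all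
   observed functionals vanish, so every recovery map is a constant, and no constant beats the mean 0:
   Psi v \<mu> is at least 1 = Psi P \<mu>. Hence (P, \<mu>) is an exact saddle point, and it remains to
   approximate the Gaussian cylinder measure by such laws: take the standard Gaussian measures on
   finite-dimensional subspaces that increase to a dense subspace of the complement. The cylinder measure
   itself is read off from the same measures, a cylinder set having the same probability under all of
   those that resolve its coordinates. This consistency, and the uniqueness of the cylinder measure, come
   from the Cramer-Wold theorem. *)

theory Submission
  imports Defs
begin

text \<open>For the given inner product \<open>Q\<close> is the Riesz isomorphism, so
  \<open>[s + t, Q (s + t)]\<close> is the squared norm of \<open>Q s + Q t\<close>. The short
  therefore sends \<open>s\<close> to the component of \<open>Q s\<close> orthogonal to
  \<open>Q \<Phi>\<close>, and its Gaussian cylinder measure is white noise on the complement. If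
  the complement has infinite dimension, the identity covariance is not of trace class and white
  noise is not a countably additive measure. This is why the cylinder measure is assembled set by
  set from finite-dimensional laws, and why the saddle point has to be reached through a sequence.
  The dimension hypothesis makes the complement nonzero, which gives the approximating laws a
  nonzero second moment. Their second moments may grow without bound, but convergence is asked only
  of finite-rank images: there the missing directions cost a mean square error bounded by the
  squared distances of finitely many vectors to the subspaces.\<close>

section \<open>The Cramer-Wold theorem\<close>

text \<open>Both parts of the characteristic function are written as cosines with a phase, the form in
  which \<open>weighted_law_unique\<close> receives its hypothesis.\<close>

lemma char_weighted_law:
  assumes M: "finite_measure M"
    and [measurable]: "w \<in> borel_measurable M" "X \<in> borel_measurable M"
    and w: "\<And>x. 0 \<le> w x" "\<And>x. w x \<le> C"
  shows "char (distr (density M (\<lambda>x. ennreal (w x))) borel X) t =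
    Complex (\<integral>x. w x * cos (0 + t * X x) \<partial>M) (\<integral>x. w x * cos (- pi / 2 + t * X x) \<partial>M)"
proof -
  interpret finite_measure M by fact
  have int: "integrable M (\<lambda>x. w x *\<^sub>R iexp (t * X x))"
  proof (rule integrable_const_bound[where B = C])
    show "AE x in M. norm (w x *\<^sub>R iexp (t * X x)) \<le> C"
      using w by (auto simp flip: of_real_mult)
  qed auto
  have "char (distr (density M w) borel X) t = (\<integral>x. w x *\<^sub>R iexp (t * X x) \<partial>M)"
    unfolding char_def using w by (simp add: integral_distr integral_density)
  moreover have "Re (\<integral>x. w x *\<^sub>R iexp (t * X x) \<partial>M) = (\<integral>x. w x * cos (0 + t * X x) \<partial>M)"
    by (subst integral_Re[OF int, symmetric]) (simp add: Re_exp)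
  moreover have "Im (\<integral>x. w x *\<^sub>R iexp (t * X x) \<partial>M) = (\<integral>x. w x * cos (- pi / 2 + t * X x) \<partial>M)"
    by (subst integral_Im[OF int, symmetric]) (simp add: Im_exp cos_diff)
  ultimately show ?thesis
    by (simp add: complex_eq_iff)
qed

text \<open>Dividing by the common total mass, which the hypothesis supplies at
  \<open>t = d = 0\<close>, turns both weighted push-forwards into probability laws. The phases 0
  and \<open>- pi / 2\<close> give the two parts of their characteristic functions, so Levy's
  theorem applies. If the mass is 0, both integrals vanish.\<close>

lemma weighted_law_unique:
  fixes M :: "'b measure" and N :: "'c measure" and C :: real
  assumes M: "finite_measure M" and N: "finite_measure N"
    and [measurable]: "w \<in> borel_measurable M" "X \<in> borel_measurable M"
      "v \<in> borel_measurable N" "Y \<in> borel_measurable N"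
    and w: "\<And>x. 0 \<le> w x" "\<And>x. w x \<le> C" and v: "\<And>x. 0 \<le> v x" "\<And>x. v x \<le> C"
    and eq: "\<And>t d. (\<integral>x. w x * cos (d + t * X x) \<partial>M) = (\<integral>x. v x * cos (d + t * Y x) \<partial>N)"
    and A[measurable]: "A \<in> sets borel"
  shows "(\<integral>x. w x * indicator A (X x) \<partial>M) = (\<integral>x. v x * indicator A (Y x) \<partial>N)"
proof -
  interpret M: finite_measure M by fact
  interpret N: finite_measure N by fact
  define m where "m = (\<integral>x. w x \<partial>M)"
  have m': "m = (\<integral>x. v x \<partial>N)" using eq[of 0 0] by (simp add: m_def)
  have iw: "integrable M w"
    using w by (intro M.integrable_const_bound[where B = C]) auto
  have iv: "integrable N v"
    using v by (intro N.integrable_const_bound[where B = C]) auto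
  have "m \<ge> 0" unfolding m_def using w by simp
  then consider "m = 0" | "m > 0" by linarith
  then show ?thesis
  proof cases
    case 1
    have "AE x in M. w x = 0"
      using integral_nonneg_eq_0_iff_AE[OF iw] w 1 by (simp add: m_def)
    then have "(\<integral>x. w x * indicator A (X x) \<partial>M) = 0"
      by (intro integral_eq_zero_AE) auto
    moreover have "AE x in N. v x = 0"
      using integral_nonneg_eq_0_iff_AE[OF iv] v 1 by (simp add: m')
    then have "(\<integral>x. v x * indicator A (Y x) \<partial>N) = 0"
      by (intro integral_eq_zero_AE) auto
    ultimately show ?thesis by simp
  next
    case 2
    define M' where "M' = distr (density M (\<lambda>x. ennreal (w x / m))) borel X"
    define N' where "N' = distr (density N (\<lambda>x. ennreal (v x / m))) borel Y"
    have "prob_space (density M (\<lambda>x. ennreal (w x / m)))"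
      using 2 w iw by (intro prob_spaceI) (simp add: emeasure_density nn_integral_eq_integral m_def)
    then have M': "real_distribution M'"
      unfolding M'_def by (intro prob_space.real_distribution_distr) auto
    have "prob_space (density N (\<lambda>x. ennreal (v x / m)))"
      using 2 v iv by (intro prob_spaceI) (simp add: emeasure_density nn_integral_eq_integral m')
    then have N': "real_distribution N'"
      unfolding N'_def by (intro prob_space.real_distribution_distr) auto
    have "(\<integral>x. w x / m * cos (d + t * X x) \<partial>M) = (\<integral>x. v x / m * cos (d + t * Y x) \<partial>N)" for t d
      using eq[of d t] by simp
    moreover have "char M' t = Complex (\<integral>x. w x / m * cos (0 + t * X x) \<partial>M) (\<integral>x. w x / m * cos (- pi / 2 + t * X x) \<partial>M)" for t
      unfolding M'_def using 2 w M
      by (intro char_weighted_law[where C = "C / m"]) (auto intro!: divide_right_mono)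
    moreover have "char N' t = Complex (\<integral>x. v x / m * cos (0 + t * Y x) \<partial>N) (\<integral>x. v x / m * cos (- pi / 2 + t * Y x) \<partial>N)" for t
      unfolding N'_def using 2 v N
      by (intro char_weighted_law[where C = "C / m"]) (auto intro!: divide_right_mono)
    ultimately have "char M' t = char N' t" for t
      by presburger
    then have "M' = N'"
      using Levy_uniqueness[OF M' N'] by blast
    moreover have "(\<integral>x. indicat_real A x \<partial>M') = (\<integral>x. w x / m * indicator A (X x) \<partial>M)"
      unfolding M'_def using 2 w by (subst integral_distr, simp, simp, subst integral_density) auto
    moreover have "(\<integral>x. indicat_real A x \<partial>N') = (\<integral>x. v x / m * indicator A (Y x) \<partial>N)"
      unfolding N'_def using 2 v by (subst integral_distr, simp, simp, subst integral_density) auto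
    ultimately have "(\<integral>x. w x / m * indicator A (X x) \<partial>M) = (\<integral>x. v x / m * indicator A (Y x) \<partial>N)"
      by simp
    then show ?thesis using 2 by simp
  qed
qed

lemma prod_indicator_01:
  "0 \<le> (\<Prod>i<j. indicat_real (A i) (x i))" "(\<Prod>i<j. indicat_real (A i) (x i)) \<le> 1"
  by (auto intro!: prod_nonneg prod_le_1)

text \<open>One coordinate after the other is passed from the trigonometric factor to the indicators by
  the one-dimensional uniqueness theorem, applied to a law with the other factors as weight; adding 1 to
  the cosine makes this weight nonnegative.\<close>

theorem Cramer_Wold:
  fixes M N :: "(nat \<Rightarrow> real) measure"
  assumes M: "prob_space M" and N: "prob_space N"
    and sM[measurable_cong]: "sets M = sets (PiM {..<k} (\<lambda>_. borel))"
    and sN[measurable_cong]: "sets N = sets (PiM {..<k} (\<lambda>_. borel))"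
    and eq: "\<And>a. distr M borel (\<lambda>x. \<Sum>i<k. a i * x i) = distr N borel (\<lambda>x. \<Sum>i<k. a i * x i)"
  shows "M = N"
proof -
  interpret M: prob_space M by fact
  interpret N: prob_space N by fact
  have fin: "finite_measure M" "finite_measure N" by unfold_locales
  \<comment> \<open>The first \<open>j\<close> coordinates are tested by indicators, the others by a
    single cosine. At \<open>j = 0\<close> only laws of linear combinations occur; at
    \<open>j = k\<close> with \<open>c = 0\<close> the integral is the measure of a box.\<close>
  define W where "W j A a c x = (\<Prod>i<j. indicat_real (A i) (x i)) * cos (c + (\<Sum>i=j..<k. a i * x i))"
    for j A and a :: "nat \<Rightarrow> real" and c :: real and x :: "nat \<Rightarrow> real"
  have meas: "W j A a c \<in> borel_measurable (PiM {..<k} (\<lambda>_. borel))"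
    if [measurable]: "\<And>i. A i \<in> sets borel" and jk: "j \<le> k" for j A a c
  proof -
    have x: "(\<lambda>x. x i) \<in> borel_measurable (PiM {..<k} (\<lambda>_. borel :: real measure))"
      if "i < k" for i using that by simp
    have "(\<lambda>x. indicat_real (A i) (x i)) \<in> borel_measurable (PiM {..<k} (\<lambda>_. borel))" if "i < j" for i
      using jk that by (intro measurable_compose[OF x]) auto
    then show ?thesis unfolding W_def
      by (intro borel_measurable_times borel_measurable_prod measurable_compose[OF _ borel_measurable_cos]
          borel_measurable_add borel_measurable_sum borel_measurable_const x) auto
  qed
  have key: "(\<integral>x. W j A a c x \<partial>M) = (\<integral>x. W j A a c x \<partial>N)"
    if jk: "j \<le> k" and A: "\<And>i. A i \<in> sets borel" for j A a c
    using jk A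
  proof (induction j arbitrary: A a c)
    case 0
    have "(\<integral>x. cos (c + x) \<partial>distr M borel (\<lambda>x. \<Sum>i<k. a i * x i)) =
      (\<integral>x. cos (c + x) \<partial>distr N borel (\<lambda>x. \<Sum>i<k. a i * x i))"
      by (simp only: eq)
    then show ?case
      by (simp add: integral_distr W_def atLeast0LessThan)
  next
    case (Suc j)
    note mA = Suc.prems(2)
    have j: "j < k" using Suc.prems by simp
    have [measurable]: "(\<lambda>x. x j) \<in> borel_measurable M" "(\<lambda>x. x j) \<in> borel_measurable N"
      using j by (simp_all add: measurable_cong_sets[OF sM refl] measurable_cong_sets[OF sN refl])
    define w where "w a c x = (\<Prod>i<j. indicat_real (A i) (x i)) * (1 + cos (c + (\<Sum>i=Suc j..<k. a i * x i)))"
      for a :: "nat \<Rightarrow> real" and c :: real and x :: "nat \<Rightarrow> real"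
    have [simp]: "0 \<le> w a c x" for a c x
      unfolding w_def using cos_ge_minus_one[of "c + (\<Sum>i=Suc j..<k. a i * x i)"] by (intro mult_nonneg_nonneg prod_indicator_01) linarith
    have [simp]: "w a c x \<le> 2" for a c x
    proof -
      have "w a c x \<le> 1 * 2"
        unfolding w_def using cos_le_one[of "c + (\<Sum>i=Suc j..<k. a i * x i)"] cos_ge_minus_one[of "c + (\<Sum>i=Suc j..<k. a i * x i)"]
        by (intro mult_mono prod_indicator_01) (linarith | simp)+
      then show ?thesis by simp
    qed
    \<comment> \<open>The product-to-sum formula produces the phases \<open>c + d\<close> and
      \<open>c - d\<close>, with coefficient \<open>t\<close> or \<open>- t\<close> at
      \<open>j\<close>. All three terms are of the form \<open>W j\<close>, so the induction
      hypothesis covers them.\<close>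
    have split: "w a c x * cos (d + t * x j) = W j A ((\<lambda>_. 0)(j := t)) d x
        + (W j A (a(j := t)) (c + d) x + W j A (a(j := - t)) (c - d) x) / 2" for a c t d x
    proof -
      have s: "(\<Sum>i=j..<k. (b(j := t)) i * x i) = t * x j + (\<Sum>i=Suc j..<k. b i * x i)" for b t
        using j by (simp add: sum.atLeast_Suc_lessThan)
      show ?thesis
        unfolding w_def W_def s by (simp add: algebra_simps cos_add cos_diff sin_add sin_diff) (simp add: field_simps)
    qed
    have [measurable]: "W j A a c \<in> borel_measurable M" "W j A a c \<in> borel_measurable N" for a c
      using meas[of A j a c] mA j by (simp_all cong: measurable_cong_sets add: sM sN)
    have int: "integrable M (W j A a c)" "integrable N (W j A a c)" for a c
    proof -
      have "\<bar>W j A a c x\<bar> \<le> 1" for x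
        unfolding W_def abs_mult using prod_indicator_01[of A x j] by (intro mult_le_one) auto
      then show "integrable M (W j A a c)" "integrable N (W j A a c)"
        by (auto intro!: M.integrable_const_bound[where B = 1] N.integrable_const_bound[where B = 1])
    qed
    have wsplit: "w a c x = W j A (\<lambda>_. 0) 0 x + W j A (a(j := 0)) c x" for a c x
      using split[of a c x 0 0] by (simp add: fun_upd_idem)
    have [measurable]: "w a c \<in> borel_measurable M" "w a c \<in> borel_measurable N" for a c
      unfolding wsplit[abs_def] by measurable
    have *: "(\<integral>x. w a c x * indicator (A j) (x j) \<partial>M) = (\<integral>x. w a c x * indicator (A j) (x j) \<partial>N)" for a c
    proof (rule weighted_law_unique[OF fin, where C = 2])
      show "(\<integral>x. w a c x * cos (d + t * x j) \<partial>M) = (\<integral>x. w a c x * cos (d + t * x j) \<partial>N)" for t d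
        unfolding split using int Suc.IH[OF _ mA] j by simp
    qed (use mA in auto)
    \<comment> \<open>For zero coefficients and phase the factor \<open>1 + cos\<close> equals 2;
      half of that term is exactly what the added 1 contributed.\<close>
    have W: "W (Suc j) A a c x = w a c x * indicator (A j) (x j) - w (\<lambda>_. 0) 0 x * indicator (A j) (x j) / 2" for x
      unfolding W_def w_def by (simp add: algebra_simps)
    have int': "integrable M (\<lambda>x. w a c x * indicator (A j) (x j))"
      "integrable N (\<lambda>x. w a c x * indicator (A j) (x j))" for a c
    proof -
      have "\<bar>w a c x * indicator (A j) (x j)\<bar> \<le> 2" for x
        by (auto simp: abs_mult indicator_def intro: order_trans[of _ "1 * 2"])
      then show "integrable M (\<lambda>x. w a c x * indicator (A j) (x j))"
         "integrable N (\<lambda>x. w a c x * indicator (A j) (x j))"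
        using mA by (auto intro!: M.integrable_const_bound[where B = 2] N.integrable_const_bound[where B = 2])
    qed
    show ?case
      unfolding W using int' * by simp
  qed
  show ?thesis
  proof (rule measure_eqI_PiM_finite[of "{..<k}" M "\<lambda>_. borel" N "\<lambda>_. \<Pi>\<^sub>E i\<in>{..<k}. UNIV"])
    fix A :: "nat \<Rightarrow> real set" assume A: "\<And>i. i \<in> {..<k} \<Longrightarrow> A i \<in> sets borel"
    \<comment> \<open>\<open>key\<close> wants a Borel set at every index; those from
      \<open>k\<close> on never enter \<open>W k\<close>.\<close>
    define A' where "A' i = (if i < k then A i else UNIV)" for i
    have eq: "W k A' (\<lambda>_. 0) 0 x = indicator (PiE {..<k} A) x" if ext: "x \<in> extensional {..<k}" for x
    proof (cases "x \<in> PiE {..<k} A")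
      case True
      then show ?thesis by (auto simp: W_def A'_def PiE_iff intro!: prod.neutral)
    next
      case False
      then obtain i where "i < k" "x i \<notin> A i" using ext by (auto simp: PiE_iff)
      then have "(\<Prod>i<k. indicat_real (A' i) (x i)) = 0"
        by (intro prod_zero bexI[of _ i]) (auto simp: A'_def)
      then show ?thesis using False by (simp add: W_def)
    qed
    have sp: "space M = extensional {..<k}" "space N = extensional {..<k}"
      using sets_eq_imp_space_eq[OF sM] sets_eq_imp_space_eq[OF sN] by (auto simp: space_PiM PiE_def)
    have ms: "PiE {..<k} A \<in> sets M" "PiE {..<k} A \<in> sets N"
      using A by (auto simp: sM sN intro!: sets_PiM_I_finite)
    have "PiE {..<k} A \<inter> extensional {..<k} = PiE {..<k} A" unfolding PiE_def by blast
    note sp = sp this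
    have "measure M (PiE {..<k} A) = (\<integral>x. W k A' (\<lambda>_. 0) 0 x \<partial>M)"
      using ms by (subst Bochner_Integration.integral_cong[OF refl eq]) (auto simp: sp)
    also have "\<dots> = (\<integral>x. W k A' (\<lambda>_. 0) 0 x \<partial>N)"
      using A by (intro key) (auto simp: A'_def)
    also have "\<dots> = measure N (PiE {..<k} A)"
      using ms by (subst Bochner_Integration.integral_cong[OF refl eq]) (auto simp: sp)
    finally show "emeasure M (PiE {..<k} A) = emeasure N (PiE {..<k} A)"
      by (simp add: M.emeasure_eq_measure N.emeasure_eq_measure)
  next
    show "range (\<lambda>_. \<Pi>\<^sub>E i\<in>{..<k}. UNIV) \<subseteq> prod_algebra {..<k} (\<lambda>_. borel :: real measure)"
      by (auto intro!: prod_algebraI_finite)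
  qed (auto simp: sM sN space_PiM)
qed

section \<open>Finite orthonormal systems\<close>

definition orthonormal :: "'a::real_inner set \<Rightarrow> bool" where
  "orthonormal E \<longleftrightarrow> (\<forall>u\<in>E. \<forall>v\<in>E. inner u v = (if u = v then 1 else 0))"

definition onb_proj :: "'a::real_inner set \<Rightarrow> 'a \<Rightarrow> 'a" where
  "onb_proj E x = (\<Sum>v\<in>E. inner x v *\<^sub>R v)"

lemma orthonormal_subset: "orthonormal F \<Longrightarrow> E \<subseteq> F \<Longrightarrow> orthonormal E"
  unfolding orthonormal_def by blast

lemma onb_proj_in_span: "onb_proj E x \<in> span E"
  unfolding onb_proj_def by (intro span_sum span_scale span_base)

lemma linear_onb_proj: "linear (onb_proj E)"
  unfolding onb_proj_def
  by (rule linearI) (auto simp: inner_add_left scaleR_add_left sum.distrib scaleR_sum_right)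

lemma inner_onb_proj_basis:
  assumes "finite E" "orthonormal E" "v \<in> E"
  shows "inner (onb_proj E x) v = inner x v"
proof -
  have "inner (onb_proj E x) v = (\<Sum>u\<in>E. inner x u * (if u = v then 1 else 0))"
    using assms by (auto simp: onb_proj_def inner_sum_left orthonormal_def intro!: sum.cong)
  then show ?thesis using assms by (simp add: if_distrib sum.delta cong: if_cong)
qed

lemma inner_residual_span:
  assumes "finite E" "orthonormal E" "y \<in> span E"
  shows "inner (x - onb_proj E x) y = 0"
  using assms(3)
proof (induction rule: span_induct_alt)
  case (step c v y)
  then show ?case using inner_onb_proj_basis[OF assms(1,2), of v x]
    by (simp add: inner_add_right inner_diff_left)
qed simp

text \<open>The difference of the two candidates lies in \<open>span E\<close> and is orthogonal to
  it, hence to itself.\<close>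

lemma onb_proj_unique:
  assumes E: "finite E" "orthonormal E" and y: "y \<in> span E" "\<And>v. v \<in> E \<Longrightarrow> inner (x - y) v = 0"
  shows "y = onb_proj E x"
proof -
  have d: "y - onb_proj E x \<in> span E"
    by (intro span_diff y onb_proj_in_span)
  have "inner (x - y) z = 0" if "z \<in> span E" for z
    using that by (induction rule: span_induct_alt) (auto simp: inner_add_right y)
  from this[OF d] inner_residual_span[OF E d, of x]
  have "inner (y - onb_proj E x) (y - onb_proj E x) = 0"
    by (simp add: inner_diff_left)
  then show ?thesis by simp
qed

lemma onb_proj_span: "finite E \<Longrightarrow> orthonormal E \<Longrightarrow> x \<in> span E \<Longrightarrow> onb_proj E x = x"
  using onb_proj_unique[of E x x] by simp

lemma orth_proj_span:
  assumes "finite E" "orthonormal E"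
  shows "orth_proj (span E) = onb_proj E"
proof
  fix x
  show "orth_proj (span E) x = onb_proj E x"
    unfolding orth_proj_def
  proof (rule the_equality)
    show "onb_proj E x \<in> span E \<and> (\<forall>z\<in>span E. orthogonal (x - onb_proj E x) z)"
      using inner_residual_span[OF assms] by (simp add: onb_proj_in_span orthogonal_def)
    show "y = onb_proj E x" if "y \<in> span E \<and> (\<forall>z\<in>span E. orthogonal (x - y) z)" for y
      using that by (intro onb_proj_unique assms) (auto simp: orthogonal_def span_base)
  qed
qed

lemma norm_onb_proj:
  assumes "finite E" "orthonormal E"
  shows "(norm (onb_proj E x))\<^sup>2 = (\<Sum>v\<in>E. (inner x v)\<^sup>2)"
proof -
  have "(norm (onb_proj E x))\<^sup>2 = inner (onb_proj E x) (onb_proj E x)"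
    by (simp add: power2_norm_eq_inner)
  also have "\<dots> = (\<Sum>v\<in>E. inner x v * inner (onb_proj E x) v)"
    by (subst (2) onb_proj_def) (simp add: inner_sum_right)
  also have "\<dots> = (\<Sum>v\<in>E. (inner x v)\<^sup>2)"
    using inner_onb_proj_basis[OF assms] by (simp add: power2_eq_square)
  finally show ?thesis .
qed

lemma norm_pythagoras_onb_proj:
  assumes "finite E" "orthonormal E" "y \<in> span E"
  shows "(norm (x - y))\<^sup>2 = (norm (x - onb_proj E x))\<^sup>2 + (norm (onb_proj E x - y))\<^sup>2"
proof -
  have "inner (x - onb_proj E x) (onb_proj E x - y) = 0"
    by (intro inner_residual_span assms span_diff onb_proj_in_span)
  then show ?thesis
    using norm_add_Pythagorean[of "x - onb_proj E x" "onb_proj E x - y"]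
    by (simp add: orthogonal_def)
qed

lemma Bessel:
  assumes "finite E" "orthonormal E"
  shows "(\<Sum>v\<in>E. (inner x v)\<^sup>2) \<le> (norm x)\<^sup>2"
  using norm_pythagoras_onb_proj[OF assms span_zero, of x]
  by (simp flip: norm_onb_proj[OF assms])

text \<open>Gram-Schmidt carried out on top of \<open>E\<close>, which stays a subset: for nested
  systems the Gaussian sums share the coordinates of the smaller one.\<close>

lemma orthonormal_extend:
  fixes B :: "'a::real_inner set"
  assumes "finite B" "finite E" "orthonormal E"
  obtains F where "finite F" "E \<subseteq> F" "orthonormal F" "span F = span (E \<union> B)"
proof -
  have "\<exists>F. finite F \<and> E \<subseteq> F \<and> orthonormal F \<and> span F = span (E \<union> B)"
    using assms(1)
  proof (induction rule: finite_induct)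
    case empty
    then show ?case using assms by (intro exI[of _ E]) auto
  next
    case (insert b B)
    then obtain F where F: "finite F" "E \<subseteq> F" "orthonormal F" "span F = span (E \<union> B)" by blast
    have eq: "span (E \<union> insert b B) = span (insert b F)"
      unfolding Un_insert_right span_insert F(4) ..
    define r where "r = b - onb_proj F b"
    show ?case
    proof (cases "r = 0")
      case True
      then have "b \<in> span F" using onb_proj_in_span[of F b] by (simp add: r_def)
      then have "span (insert b F) = span F" by (simp add: span_redundant)
      then show ?thesis using F eq by (intro exI[of _ F]) auto
    next
      case False
      have orth: "inner r v = 0" "inner v r = 0" if "v \<in> span F" for v
        using inner_residual_span[OF F(1,3) that, of b] by (simp_all add: r_def inner_commute)
      define q where "q = r /\<^sub>R norm r"
      have sub: "v \<in> span (insert x F)" if "v \<in> span F" for v x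
        using that span_mono[of F "insert x F"] by blast
      have "norm r *\<^sub>R q + onb_proj F b \<in> span (insert q F)"
        by (intro span_add span_scale sub[OF onb_proj_in_span]) (simp add: span_base)
      moreover have "norm r *\<^sub>R q + onb_proj F b = b" using False by (simp add: q_def r_def)
      ultimately have "b \<in> span (insert q F)" by simp
      moreover have "q \<in> span (insert b F)"
        unfolding q_def r_def by (intro span_scale span_diff sub[OF onb_proj_in_span]) (simp add: span_base)
      ultimately have "span (insert q F) = span (insert b F)"
        unfolding span_eq by (simp add: span_superset[THEN subsetD] subset_iff sub span_base)
      moreover have "inner q q = 1"
        using False by (simp add: q_def dot_square_norm power2_eq_square)
      moreover have "inner q v = 0" "inner v q = 0" if "v \<in> F" for v
        using orth[OF span_base[OF that]] by (simp_all add: q_def)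
      ultimately have "orthonormal (insert q F)" "span (insert q F) = span (insert b F)"
        using F(3) by (auto simp: orthonormal_def)
      then show ?thesis
        using F eq by (intro exI[of _ "insert q F"]) auto
    qed
  qed
  then show ?thesis using that by blast
qed

section \<open>Gaussian white noise\<close>

text \<open>The index type will be the space itself, each vector naming its own coordinate. All
  finite orthonormal systems thereby live on one probability space, which is what couplings between
  them require.\<close>

definition white_noise :: "('i \<Rightarrow> real) measure" where
  "white_noise = PiM UNIV (\<lambda>_. std_normal_distribution)"

lemma prob_space_std_normal: "prob_space std_normal_distribution"
  using real_dist_normal_dist real_distribution_def by blast

interpretation white_noise: prob_space white_noise
  unfolding white_noise_def by (intro prob_space_PiM prob_space_std_normal)

lemma space_white_noise [simp]: "space white_noise = UNIV"
  by (simp add: white_noise_def space_PiM)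

lemma measurable_white_noise [measurable]: "(\<lambda>z. z i) \<in> borel_measurable white_noise"
proof -
  have "(\<lambda>z. z i) \<in> white_noise \<rightarrow>\<^sub>M std_normal_distribution"
    unfolding white_noise_def by simp
  then show ?thesis by simp
qed

lemma distr_white_noise: "distr white_noise borel (\<lambda>z. z i) = std_normal_distribution"
proof -
  have "distr white_noise std_normal_distribution (\<lambda>z. z i) = std_normal_distribution"
    unfolding white_noise_def
    by (rule distr_PiM_component) (auto intro: prob_space_std_normal)
  then show ?thesis
    by (subst distr_cong[of _ white_noise borel std_normal_distribution]) auto
qed

lemma indep_vars_white_noise:
  assumes "finite I"
  shows "white_noise.indep_vars (\<lambda>_. borel) (\<lambda>i z. z i) I"
proof (cases "I = {}")
  case True
  then show ?thesis by (simp add: white_noise.indep_vars_def white_noise.indep_sets_def)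
next
  case False
  interpret product_prob_space "\<lambda>_ :: 'a. std_normal_distribution" UNIV
    by (simp add: product_prob_spaceI prob_space_std_normal)
  have "distr white_noise (PiM I (\<lambda>_. borel)) (\<lambda>z. restrict z I) =
      distr white_noise (PiM I (\<lambda>_. std_normal_distribution)) (\<lambda>z. restrict z I)"
    by (intro distr_cong sets_PiM_cong) auto
  also have "\<dots> = PiM I (\<lambda>i. distr white_noise borel (\<lambda>z. z i))"
    unfolding distr_white_noise unfolding white_noise_def
    by (rule distr_PiM_restrict_finite) (use assms in auto)
  finally show ?thesis
    using False by (subst white_noise.indep_vars_iff_distr_eq_PiM') (auto simp: restrict_def)
qed

text \<open>Scaling a standard normal variable also covers the point mass at \<open>s = 0\<close>,
  so degenerate laws need no separate treatment afterwards.\<close>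

lemma normal_law_square:
  assumes "s \<ge> 0"
  shows "normal_law 0 (s\<^sup>2) = distr std_normal_distribution borel (\<lambda>x. s * x)"
proof (cases "s = 0")
  case True
  then show ?thesis
    using prob_space.distr_const[OF prob_space_std_normal, of "0::real" borel] by (simp add: normal_law_def)
next
  case False
  then have s: "s > 0" using assms by simp
  interpret prob_space std_normal_distribution by (rule prob_space_std_normal)
  have "distributed std_normal_distribution lborel (\<lambda>x. x) (normal_density 0 1)"
    by (auto simp: distributed_def distr_id2)
  from normal_density_affine[OF this, of s 0] s
  have "distr std_normal_distribution lborel (\<lambda>x. s * x) = density lborel (normal_density 0 s)"
    by (simp add: distributed_def)
  moreover have "distr std_normal_distribution lborel (\<lambda>x. s * x) = distr std_normal_distribution borel (\<lambda>x. s * x)"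
    by (intro distr_cong) auto
  ultimately show ?thesis
    using s by (simp add: normal_law_def)
qed

lemma char_scaled_std_normal:
  "char (distr std_normal_distribution borel (\<lambda>x. s * x)) t = exp (- (t\<^sup>2 * s\<^sup>2) / 2)"
proof -
  have "char (distr std_normal_distribution borel (\<lambda>x. s * x)) t = char std_normal_distribution (t * s)"
    unfolding char_def by (simp add: integral_distr mult.assoc)
  then show ?thesis by (simp add: char_std_normal_distribution power_mult_distrib)
qed

text \<open>Independence multiplies the characteristic functions, so the squared coefficients add in
  the exponent.\<close>

lemma white_noise_sum_law:
  assumes "finite I"
  shows "distr white_noise borel (\<lambda>z. \<Sum>i\<in>I. a i * z i) = normal_law 0 (\<Sum>i\<in>I. (a i)\<^sup>2)"
proof -
  define s where "s = sqrt (\<Sum>i\<in>I. (a i)\<^sup>2)"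
  have s: "s \<ge> 0" "s\<^sup>2 = (\<Sum>i\<in>I. (a i)\<^sup>2)" by (auto simp: s_def sum_nonneg)
  have ind: "white_noise.indep_vars (\<lambda>_. borel) (\<lambda>i z. a i * z i) I"
    using white_noise.indep_vars_compose2[OF indep_vars_white_noise[OF assms], of "\<lambda>i x. a i * x" "\<lambda>_. borel"]
    by simp
  have c: "char (distr white_noise borel (\<lambda>z. a i * z i)) t = exp (- (t\<^sup>2 * (a i)\<^sup>2) / 2)" for i t
  proof -
    have "distr white_noise borel (\<lambda>z. a i * z i) = distr (distr white_noise borel (\<lambda>z. z i)) borel (\<lambda>x. a i * x)"
      by (subst distr_distr) (auto simp: comp_def)
    then show ?thesis by (simp only: distr_white_noise char_scaled_std_normal)
  qed
  have "distr white_noise borel (\<lambda>z. \<Sum>i\<in>I. a i * z i) = distr std_normal_distribution borel (\<lambda>x. s * x)"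
  proof (rule Levy_uniqueness)
    show "real_distribution (distr std_normal_distribution borel (\<lambda>x. s * x))"
      by (intro prob_space.real_distribution_distr prob_space_std_normal) auto
    show "char (distr white_noise borel (\<lambda>z. \<Sum>i\<in>I. a i * z i)) = char (distr std_normal_distribution borel (\<lambda>x. s * x))"
      unfolding white_noise.char_distr_sum[OF ind] c char_scaled_std_normal s
      by (simp add: fun_eq_iff exp_sum[OF assms, symmetric] sum_distrib_left sum_divide_distrib sum_negf
          flip: of_real_prod)
  qed auto
  then show ?thesis using normal_law_square[OF s(1)] s(2) by simp
qed

lemma white_noise_mean: "integrable white_noise (\<lambda>z. z i)" "(\<integral>z. z i \<partial>white_noise) = 0"
proof -
  have "integrable (distr white_noise borel (\<lambda>z. z i)) (\<lambda>x. x)"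
    "(\<integral>x. x \<partial>(distr white_noise borel (\<lambda>z. z i))) = 0"
    using integrable_std_normal_distribution_moment[of 1] integral_std_normal_distribution_moment_odd[of 1]
    by (simp_all add: distr_white_noise)
  then show "integrable white_noise (\<lambda>z. z i)" "(\<integral>z. z i \<partial>white_noise) = 0"
    by (simp_all add: integrable_distr_eq integral_distr)
qed

lemma white_noise_covariance:
  "integrable white_noise (\<lambda>z. z i * z j)" 
  "(\<integral>z. z i * z j \<partial>white_noise) = (if i = j then 1 else 0)"
proof -
  have "integrable white_noise (\<lambda>z. z i * z j) \<and> (\<integral>z. z i * z j \<partial>white_noise) = (if i = j then 1 else 0)"
  proof (cases "i = j")
    case True
    have "integrable (distr white_noise borel (\<lambda>z. z i)) (\<lambda>x. x * x)"
      "(\<integral>x. x * x \<partial>(distr white_noise borel (\<lambda>z. z i))) = 1"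
      using std_normal_distribution_even_moments[of 1] by (simp_all add: distr_white_noise power2_eq_square)
    then show ?thesis
      using True by (simp add: integrable_distr_eq integral_distr)
  next
    case False
    have ind: "white_noise.indep_vars (\<lambda>_. borel) (\<lambda>i z. z i) {i, j}"
      by (intro indep_vars_white_noise) simp
    from white_noise.indep_vars_integrable[OF _ ind white_noise_mean(1)]
      white_noise.indep_vars_lebesgue_integral[OF _ ind white_noise_mean(1)]
    show ?thesis using False by (simp add: white_noise_mean)
  qed
  then show "integrable white_noise (\<lambda>z. z i * z j)" 
    "(\<integral>z. z i * z j \<partial>white_noise) = (if i = j then 1 else 0)" by auto
qed

text \<open>The off-diagonal covariances vanish, whatever the angles between the \<open>w i\<close>.
  The vectors are arbitrary because the lemma serves orthonormal systems as well as their images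
  under a finite-rank map.\<close>

lemma white_noise_sum_second_moment:
  fixes w :: "'i \<Rightarrow> 'b::real_inner"
  assumes "finite I"
  shows "integrable white_noise (\<lambda>z. (norm (\<Sum>i\<in>I. z i *\<^sub>R w i))\<^sup>2)"
    and "(\<integral>z. (norm (\<Sum>i\<in>I. z i *\<^sub>R w i))\<^sup>2 \<partial>white_noise) = (\<Sum>i\<in>I. (norm (w i))\<^sup>2)"
proof -
  have eq: "(norm (\<Sum>i\<in>I. z i *\<^sub>R w i))\<^sup>2 = (\<Sum>i\<in>I. \<Sum>j\<in>I. (z i * z j) * inner (w i) (w j))" for z
    unfolding power2_norm_eq_inner 
    by (simp add: inner_sum_left inner_sum_right sum_distrib_left ac_simps inner_commute)
  show "integrable white_noise (\<lambda>z. (norm (\<Sum>i\<in>I. z i *\<^sub>R w i))\<^sup>2)"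
    unfolding eq
    by (intro Bochner_Integration.integrable_sum integrable_mult_left white_noise_covariance(1))
  have "(\<integral>z. (norm (\<Sum>i\<in>I. z i *\<^sub>R w i))\<^sup>2 \<partial>white_noise) =
    (\<Sum>i\<in>I. \<Sum>j\<in>I. (if i = j then 1 else 0) * inner (w i) (w j))"
    unfolding eq
    by (simp add: Bochner_Integration.integral_sum Bochner_Integration.integrable_sum white_noise_covariance)
  then show "(\<integral>z. (norm (\<Sum>i\<in>I. z i *\<^sub>R w i))\<^sup>2 \<partial>white_noise) = (\<Sum>i\<in>I. (norm (w i))\<^sup>2)"
    using assms by (simp add: power2_norm_eq_inner if_distribR sum.delta if_distrib cong: if_cong)
qed

section \<open>Weak convergence by coupling\<close>

text \<open>For a fixed \<open>b\<close> both conditions are open in \<open>a\<close>; the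
  existential quantifier is a union over \<open>b\<close>.\<close>

lemma open_oscillation:
  fixes h :: "'a::metric_space \<Rightarrow> real"
  assumes "continuous_on UNIV h"
  shows "open {a. \<exists>b. dist a b < r \<and> \<bar>h a - h b\<bar> > e}"
proof -
  have "{a. \<exists>b. dist a b < r \<and> \<bar>h a - h b\<bar> > e} = (\<Union>b. {a. dist a b < r} \<inter> {a. e < \<bar>h a - h b\<bar>})"
    by auto
  moreover have "open ({a. dist a b < r} \<inter> {a. e < \<bar>h a - h b\<bar>})" for b
    by (intro open_Int open_Collect_less continuous_intros assms)
  ultimately show ?thesis by auto
qed

text \<open>A continuous function need not be uniformly continuous, but the set of points at which its
  oscillation on scale \<open>1 / Suc j\<close> exceeds \<open>e\<close> decreases to the empty set, so
  its measure under the fixed law \<open>\<nu>\<close> is small; no compactness is needed.\<close>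

lemma weakly_converges_coupling:
  fixes X Y :: "nat \<Rightarrow> 'b \<Rightarrow> 'a::{metric_space, second_countable_topology}"
  assumes M: "prob_space M"
    and [measurable]: "\<And>n. X n \<in> borel_measurable M" "\<And>n. Y n \<in> borel_measurable M"
    and law: "\<And>n. distr M borel (Y n) = \<nu>"
    and conv: "\<And>d. d > 0 \<Longrightarrow> (\<lambda>n. measure M {\<omega>\<in>space M. d \<le> dist (X n \<omega>) (Y n \<omega>)}) \<longlonglongrightarrow> 0"
  shows "weakly_converges (\<lambda>n. distr M borel (X n)) \<nu>"
  unfolding weakly_converges_def
proof safe
  fix h :: "'a \<Rightarrow> real"
  assume h: "continuous_on UNIV h" "bounded (range h)"
  interpret prob_space M by fact
  have \<nu>: "prob_space \<nu>" "sets \<nu> = sets borel"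
    using law[of 0, symmetric] by (auto intro: prob_space_distr)
  interpret \<nu>: prob_space \<nu> by fact
  have [measurable]: "h \<in> borel_measurable borel"
    using h(1) by (rule borel_measurable_continuous_onI)
  from h(2) obtain B where B: "B > 0" "\<And>x. \<bar>h x\<bar> \<le> B"
    by (auto simp: bounded_pos)
  show "(\<lambda>n. \<integral>x. h x \<partial>distr M borel (X n)) \<longlonglongrightarrow> (\<integral>x. h x \<partial>\<nu>)"
  proof (rule LIMSEQ_I)
    fix r :: real assume r: "r > 0"
    \<comment> \<open>Three contributions of at most \<open>e\<close> each, from the typical points,
      from \<open>?bad\<close> and from \<open>?far\<close>, add up to less than
      \<open>r\<close>.\<close>
    define e where "e = r / 4"
    have e: "e > 0" using r by (simp add: e_def)
    define U where "U j = {a. \<exists>b. dist a b < 1 / Suc j \<and> \<bar>h a - h b\<bar> > e}" for j :: nat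
    have U[measurable]: "U j \<in> sets borel" for j
      unfolding U_def using open_oscillation[OF h(1)] by simp
    have "decseq U"
    proof (rule decseq_SucI)
      fix j
      have "1 / real (Suc (Suc j)) \<le> 1 / real (Suc j)" by (intro divide_left_mono) auto
      then show "U (Suc j) \<subseteq> U j"
        unfolding U_def by (blast intro: less_le_trans)
    qed
    moreover have "(\<Inter>j. U j) = {}"
    proof (rule ccontr)
      assume "(\<Inter>j. U j) \<noteq> {}"
      then obtain a where a: "\<And>j. a \<in> U j" by auto
      have "isCont h a" using h(1) by (simp add: continuous_on_eq_continuous_at)
      then obtain d where d: "d > 0" "\<And>b. dist b a < d \<Longrightarrow> dist (h b) (h a) < e"
        using e unfolding continuous_at_eps_delta by blast
      obtain j where j: "inverse (Suc j) < d" using d(1) reals_Archimedean by blast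
      obtain b where b: "dist a b < 1 / Suc j" "\<bar>h a - h b\<bar> > e"
        using a[of j] by (auto simp: U_def)
      have "dist b a < d" using b(1) j by (simp add: dist_commute inverse_eq_divide)
      from d(2)[OF this] b(2) show False by (simp add: dist_real_def)
    qed
    ultimately have "(\<lambda>j. measure \<nu> (U j)) \<longlonglongrightarrow> 0"
      using \<nu>.finite_Lim_measure_decseq[of U] \<nu>(2) U by (simp add: image_subset_iff)
    moreover have eB: "e / (2 * B) > 0" using e B by simp
    ultimately obtain j where j: "measure \<nu> (U j) < e / (2 * B)"
      using LIMSEQ_D[of "\<lambda>j. measure \<nu> (U j)" 0 "e / (2 * B)"] by auto
    define d where "d = 1 / real (Suc j)"
    have "(\<lambda>n. measure M {\<omega>\<in>space M. d \<le> dist (X n \<omega>) (Y n \<omega>)}) \<longlonglongrightarrow> 0"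
      by (rule conv) (simp add: d_def)
    from LIMSEQ_D[OF this eB] obtain N where
      N: "\<And>n. n \<ge> N \<Longrightarrow> measure M {\<omega>\<in>space M. d \<le> dist (X n \<omega>) (Y n \<omega>)} < e / (2 * B)"
      by auto
    have "norm ((\<integral>x. h x \<partial>distr M borel (X n)) - (\<integral>x. h x \<partial>\<nu>)) < r" if n: "n \<ge> N" for n
    proof -
      let ?far = "{\<omega>\<in>space M. d \<le> dist (X n \<omega>) (Y n \<omega>)}"
      \<comment> \<open>The oscillation is tested at \<open>Y n\<close>, whose law is \<nu> for
        every \<open>n\<close>, so one \<open>j\<close> serves all \<open>n\<close>.\<close>
      let ?bad = "Y n -` U j \<inter> space M"
      have int: "integrable M (\<lambda>\<omega>. h (X n \<omega>))" "integrable M (\<lambda>\<omega>. h (Y n \<omega>))"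
        using B by (auto intro!: integrable_const_bound[where B = B])
      have bad: "measure M ?bad = measure \<nu> (U j)"
        unfolding law[of n, symmetric] by (simp add: measure_distr)
      have sets: "?bad \<in> sets M" "?far \<in> sets M" by measurable
      have int': "integrable M (\<lambda>\<omega>. e + 2 * B * indicator ?bad \<omega> + 2 * B * indicator ?far \<omega>)"
        using sets by (intro Bochner_Integration.integrable_add integrable_mult_right integrable_real_indicator
            integrable_const) (auto simp: emeasure_eq_measure)
      have pt: "\<bar>h (X n \<omega>) - h (Y n \<omega>)\<bar> \<le> e + 2 * B * indicator ?bad \<omega> + 2 * B * indicator ?far \<omega>"
        if "\<omega> \<in> space M" for \<omega>
      proof (cases "\<omega> \<in> ?bad \<or> \<omega> \<in> ?far")
        case True
        moreover have "\<bar>h (X n \<omega>) - h (Y n \<omega>)\<bar> \<le> 2 * B"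
          using B(2)[of "X n \<omega>"] B(2)[of "Y n \<omega>"] by linarith
        ultimately show ?thesis using e B(1) by (auto simp: indicator_def)
      next
        case False
        then have "\<not> \<bar>h (Y n \<omega>) - h (X n \<omega>)\<bar> > e"
          using that by (auto simp: U_def d_def dist_commute)
        moreover have "indicat_real ?bad \<omega> = 0" "indicat_real ?far \<omega> = 0"
          using False by auto
        ultimately show ?thesis by simp
      qed
      have "norm ((\<integral>x. h x \<partial>distr M borel (X n)) - (\<integral>x. h x \<partial>\<nu>)) =
          \<bar>\<integral>\<omega>. h (X n \<omega>) - h (Y n \<omega>) \<partial>M\<bar>"
        unfolding law[of n, symmetric] using int by (simp add: integral_distr)
      also have "\<dots> \<le> (\<integral>\<omega>. \<bar>h (X n \<omega>) - h (Y n \<omega>)\<bar> \<partial>M)"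
        by (rule integral_abs_bound)
      also have "\<dots> \<le> (\<integral>\<omega>. e + 2 * B * indicator ?bad \<omega> + 2 * B * indicator ?far \<omega> \<partial>M)"
        using int int' pt by (intro integral_mono) auto
      also have "\<dots> = e + 2 * B * measure M ?bad + 2 * B * measure M ?far"
        using sets by (simp add: prob_space emeasure_eq_measure)
      also have "\<dots> < e + 2 * B * (e / (2 * B)) + 2 * B * (e / (2 * B))"
        unfolding bad using j N[OF n] B(1) by (intro add_less_le_mono add_strict_left_mono mult_strict_left_mono mult_left_mono) auto
      also have "\<dots> < r" using B(1) r by (simp add: e_def)
      finally show ?thesis .
    qed
    then show "\<exists>N. \<forall>n\<ge>N. norm ((\<integral>x. h x \<partial>distr M borel (X n)) - (\<integral>x. h x \<partial>\<nu>)) < r"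
      by blast
  qed
qed

section \<open>Gaussian cylinder measures\<close>

lemma measurable_blinfun_apply [measurable]:
  "blinfun_apply (F :: 'a::real_normed_vector \<Rightarrow>\<^sub>L 'b::real_normed_vector) \<in> borel_measurable borel"
  by (intro borel_measurable_continuous_onI linear_continuous_on blinfun.bounded_linear_right)

lemma measurable_coord_map [measurable]: "coord_map k f \<in> borel \<rightarrow>\<^sub>M borel_power k"
  unfolding coord_map_def by measurable

lemma coord_map_apply [simp]: "i < k \<Longrightarrow> coord_map k f x i = blinfun_apply (f i) x"
  by (simp add: coord_map_def)

lemma coord_map_in_space: "coord_map k f x \<in> space (borel_power k)"
  by (auto simp: coord_map_def space_PiM)

text \<open>Selecting coordinates is measurable, so a cylinder set can be described over any longer
  tuple that contains its functionals.\<close>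

lemma coord_map_vimage_reindex:
  assumes A: "A \<in> sets (borel_power k)" and \<sigma>: "\<And>i. i < k \<Longrightarrow> \<sigma> i < l \<and> h (\<sigma> i) = f i"
  obtains A' where "A' \<in> sets (borel_power l)" "coord_map k f -` A = coord_map l h -` A'"
proof
  let ?r = "\<lambda>y :: nat \<Rightarrow> real. \<lambda>i\<in>{..<k}. y (\<sigma> i)"
  have r: "?r \<in> borel_power l \<rightarrow>\<^sub>M borel_power k"
    using \<sigma> by (intro measurable_restrict) auto
  show "?r -` A \<inter> space (borel_power l) \<in> sets (borel_power l)"
    using measurable_sets[OF r A] .
  have "?r (coord_map l h x) = coord_map k f x" for x
    using \<sigma> by (auto simp: coord_map_def fun_eq_iff)
  then show "coord_map k f -` A = coord_map l h -` (?r -` A \<inter> space (borel_power l))"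
    by (auto simp: coord_map_in_space)
qed

text \<open>The two tuples are concatenated. Finite additivity needs both sets over the same
  coordinate map.\<close>

lemma cylinder_sets_common_coordinates:
  assumes "C \<in> cylinder_sets" "D \<in> cylinder_sets"
  obtains k f A B where "A \<in> sets (borel_power k)" "C = coord_map k f -` A"
    "B \<in> sets (borel_power k)" "D = coord_map k f -` B"
proof -
  from assms obtain k f A l g B where
    A: "A \<in> sets (borel_power k)" "C = coord_map k f -` A" and
    B: "B \<in> sets (borel_power l)" "D = coord_map l g -` B"
    by (auto simp: cylinder_sets_def)
  define h where "h i = (if i < k then f i else g (i - k))" for i
  obtain A' where "A' \<in> sets (borel_power (k + l))" "C = coord_map (k + l) h -` A'"
    using coord_map_vimage_reindex[OF A(1), of "\<lambda>i. i" "k + l" h f] A(2) by (auto simp: h_def)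
  moreover obtain B' where "B' \<in> sets (borel_power (k + l))" "D = coord_map (k + l) h -` B'"
    using coord_map_vimage_reindex[OF B(1), of "\<lambda>i. k + i" "k + l" h g] B(2) by (auto simp: h_def)
  ultimately show ?thesis using that by blast
qed

section \<open>Push-forwards of set functions given only on cylinder sets\<close>

lemma sets_pushforward [simp]: "sets (pushforward N F \<mu>) = sets N"
  by (simp add: pushforward_def)

lemma space_pushforward [simp]: "space (pushforward N F \<mu>) = space N"
  by (simp add: pushforward_def)

lemma pushforward_eqI:
  assumes "sets P = sets N" "\<And>A. A \<in> sets N \<Longrightarrow> \<mu> (F -` A) = emeasure P A"
  shows "pushforward N F \<mu> = P"
proof -
  have "pushforward N F \<mu> = measure_of (space N) (sets N) (emeasure P)"
    unfolding pushforward_def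
    by (rule measure_of_eq) (use assms(2) in \<open>auto simp: sets.space_closed sets.sigma_sets_eq\<close>)
  then show ?thesis
    using measure_of_of_measure[of P] assms(1) sets_eq_imp_space_eq[OF assms(1)] by simp
qed

text \<open>\<open>measure_of\<close> falls back to the null measure if the set function is not a
  measure; total mass 1 excludes this.\<close>

lemma emeasure_pushforward:
  assumes "prob_space (pushforward N F \<mu>)" "A \<in> sets N"
  shows "emeasure (pushforward N F \<mu>) A = \<mu> (F -` A)"
proof -
  have *: "emeasure (pushforward N F \<mu>) B =
      (if B \<in> sets N \<and> measure_space (space N) (sets N) (\<lambda>A. \<mu> (F -` A)) then \<mu> (F -` B) else 0)" for B
    unfolding pushforward_def
    by (simp add: emeasure_measure_of_conv sets.sigma_sets_eq)
  have "emeasure (pushforward N F \<mu>) (space N) = 1"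
    using prob_space.emeasure_space_1[OF assms(1)] by simp
  then have "measure_space (space N) (sets N) (\<lambda>A. \<mu> (F -` A))"
    unfolding * by (auto split: if_splits)
  then show ?thesis using assms(2) by (simp add: *)
qed

lemma pushforward_compose:
  assumes "prob_space (pushforward N F \<mu>)" "L \<in> N \<rightarrow>\<^sub>M N'" "\<And>x. F x \<in> space N"
  shows "pushforward N' (\<lambda>x. L (F x)) \<mu> = distr (pushforward N F \<mu>) N' L"
proof (rule pushforward_eqI)
  fix A assume A: "A \<in> sets N'"
  have "(\<lambda>x. L (F x)) -` A = F -` (L -` A \<inter> space N)" using assms(3) by auto
  then show "\<mu> ((\<lambda>x. L (F x)) -` A) = emeasure (distr (pushforward N F \<mu>) N' L) A"
    using assms A emeasure_pushforward[OF assms(1)]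
    by (subst emeasure_distr) (auto simp: measurable_def)
qed simp

text \<open>\<open>cylinder_of\<close> carries information on cylinder sets only. The factorisation
  of \<open>F\<close> through coordinates makes every preimage under \<open>F\<close> a cylinder
  set.\<close>

lemma pushforward_cylinder_of:
  fixes \<gamma> :: "'a::real_normed_vector measure"
  assumes L: "L \<in> borel_power k \<rightarrow>\<^sub>M N" and \<gamma>: "sets \<gamma> = sets borel"
    and F: "\<And>x. F x = L (coord_map k f x)"
  shows "pushforward N F (cylinder_of \<gamma>) = distr \<gamma> N F"
proof (rule pushforward_eqI)
  fix A assume A: "A \<in> sets N"
  have eq: "F -` A = coord_map k f -` (L -` A \<inter> space (borel_power k))"
    using F coord_map_in_space by auto
  then have "F -` A \<in> cylinder_sets"
    using measurable_sets[OF L A] unfolding cylinder_sets_def by blast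
  moreover have "F \<in> \<gamma> \<rightarrow>\<^sub>M N"
    unfolding F[abs_def] using L \<gamma> by (intro measurable_compose[OF _ L]) (simp add: measurable_cong_sets[OF \<gamma> refl])
  moreover have "space \<gamma> = UNIV" using sets_eq_imp_space_eq[OF \<gamma>] by simp
  ultimately show "cylinder_of \<gamma> (F -` A) = emeasure (distr \<gamma> N F) A"
    using A by (simp add: cylinder_of_def emeasure_distr)
qed simp

lemma coord_sum_measurable [measurable]:
  "(\<lambda>x. \<Sum>i<k. a i * x i) \<in> borel_measurable (borel_power k)"
  by (intro borel_measurable_sum borel_measurable_times borel_measurable_const measurable_component_singleton)

lemma coord_sum_coord_map:
  "(\<Sum>i<k. a i * coord_map k f x i) = blinfun_apply (\<Sum>i<k. a i *\<^sub>R f i) x"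
  by (simp add: blinfun.sum_left blinfun.scaleR_left)

text \<open>Linear combinations of functionals are again functionals, so the prescribed
  one-dimensional laws determine every coordinate law; off the cylinder sets extensionality
  decides.\<close>

lemma gaussian_cylinder_measure_unique:
  assumes \<mu>: "is_gaussian_cylinder_measure T \<mu>" and \<nu>: "is_gaussian_cylinder_measure T \<nu>"
  shows "\<mu> = \<nu>"
proof
  fix C
  have CM: "\<mu> \<in> CM" "\<nu> \<in> CM" using \<mu> \<nu> by (auto simp: is_gaussian_cylinder_measure_def)
  show "\<mu> C = \<nu> C"
  proof (cases "C \<in> cylinder_sets")
    case False
    then show ?thesis using CM by (auto simp: CM_def extensional_def)
  next
    case True
    then obtain k f A where A: "A \<in> sets (borel_power k)" "C = coord_map k f -` A"
      by (auto simp: cylinder_sets_def)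
    have prob: "prob_space (pushforward (borel_power k) (coord_map k f) \<mu>)"
      "prob_space (pushforward (borel_power k) (coord_map k f) \<nu>)"
      using CM by (auto simp: CM_def)
    have "pushforward (borel_power k) (coord_map k f) \<mu> = pushforward (borel_power k) (coord_map k f) \<nu>"
    proof (rule Cramer_Wold[OF prob])
      fix a
      have "pushforward borel (blinfun_apply (\<Sum>i<k. a i *\<^sub>R f i)) \<mu> = pushforward borel (blinfun_apply (\<Sum>i<k. a i *\<^sub>R f i)) \<nu>"
        using \<mu> \<nu> by (simp add: is_gaussian_cylinder_measure_def)
      then show "distr (pushforward (borel_power k) (coord_map k f) \<mu>) borel (\<lambda>x. \<Sum>i<k. a i * x i) =
        distr (pushforward (borel_power k) (coord_map k f) \<nu>) borel (\<lambda>x. \<Sum>i<k. a i * x i)"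
        unfolding pushforward_compose[OF prob(1) coord_sum_measurable coord_map_in_space, symmetric]
          pushforward_compose[OF prob(2) coord_sum_measurable coord_map_in_space, symmetric]
          coord_sum_coord_map .
    qed auto
    then show ?thesis
      using emeasure_pushforward[OF prob(1) A(1)] emeasure_pushforward[OF prob(2) A(1)] A(2) by simp
  qed
qed

section \<open>Standard Gaussian measures on finite-dimensional subspaces\<close>

definition noise_sum :: "'a::real_vector set \<Rightarrow> ('a \<Rightarrow> real) \<Rightarrow> 'a" where
  "noise_sum E z = (\<Sum>v\<in>E. z v *\<^sub>R v)"

definition gauss_on :: "'a::{real_inner, polish_space} set \<Rightarrow> 'a measure" where
  "gauss_on E = distr white_noise borel (noise_sum E)"

lemma measurable_noise_sum [measurable]:
  "noise_sum (E :: 'a::{real_inner, polish_space} set) \<in> borel_measurable white_noise"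
  unfolding noise_sum_def by measurable

lemma sets_gauss_on [simp]: "sets (gauss_on E) = sets borel"
  by (simp add: gauss_on_def)

lemma space_gauss_on [simp]: "space (gauss_on E) = UNIV"
  by (simp add: gauss_on_def)

lemma measurable_gauss_on [simp]: "f \<in> gauss_on E \<rightarrow>\<^sub>M N \<longleftrightarrow> f \<in> borel \<rightarrow>\<^sub>M N"
  by (simp add: measurable_cong_sets[OF sets_gauss_on refl])

lemma prob_space_gauss_on: "prob_space (gauss_on E)"
  unfolding gauss_on_def by (intro white_noise.prob_space_distr) simp

lemma gauss_on_functional_law:
  assumes "finite E"
  shows "distr (gauss_on E) borel (blinfun_apply f) = normal_law 0 (\<Sum>v\<in>E. (blinfun_apply f v)\<^sup>2)"
proof -
  have "distr (gauss_on E) borel (blinfun_apply f) =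
      distr white_noise borel (\<lambda>z. \<Sum>v\<in>E. blinfun_apply f v * z v)"
    unfolding gauss_on_def
    by (subst distr_distr) (auto simp: comp_def noise_sum_def blinfun.sum_right blinfun.scaleR_right mult.commute)
  then show ?thesis by (simp add: white_noise_sum_law[OF assms])
qed

text \<open>\<open>riesz\<close> says that \<open>Q\<close> maps a functional to the vector
  representing it. \<open>E0\<close> stands for an orthonormal basis of \<open>Q \<Phi>\<close>, the
  part of the space that the observations determine.\<close>

locale gaussian_residual =
  fixes Q :: "'a::{real_inner, polish_space} dual \<Rightarrow>\<^sub>L 'a" and E0 :: "'a set"
  assumes riesz: "\<And>f x. blinfun_apply f x = inner (blinfun_apply Q f) x"
    and E0: "finite E0" "orthonormal E0"
begin

text \<open>The unobserved part of \<open>f\<close>. As an operator this turns out to be the short,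
  and the squared norm of \<open>resid f\<close> is the variance of \<open>f\<close>.\<close>

definition resid :: "'a dual \<Rightarrow> 'a" where
  "resid f = blinfun_apply Q f - onb_proj E0 (blinfun_apply Q f)"

definition admissible :: "'a set \<Rightarrow> bool" where
  "admissible E \<longleftrightarrow> finite E \<and> orthonormal E \<and> (\<forall>v\<in>E. \<forall>u\<in>E0. inner v u = 0)"

lemma linear_resid: "linear resid"
  unfolding resid_def[abs_def]
  by (intro linear_compose_sub linear_compose[unfolded comp_def, OF _ linear_onb_proj]
      bounded_linear.linear blinfun.bounded_linear_right)

lemma resid_orthogonal: "y \<in> span E0 \<Longrightarrow> inner (resid f) y = 0"
  unfolding resid_def using inner_residual_span[OF E0] .

lemma inner_resid:
  assumes "\<And>u. u \<in> E0 \<Longrightarrow> inner v u = 0"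
  shows "inner (resid f) v = blinfun_apply f v"
proof -
  have "inner (onb_proj E0 y) v = (\<Sum>u\<in>E0. inner y u * inner v u)" for y
    by (simp add: onb_proj_def inner_sum_left) (simp add: inner_commute)
  then show ?thesis using assms by (simp add: resid_def inner_diff_left riesz[of f])
qed

text \<open>Gram-Schmidt only forms linear combinations, and these stay orthogonal to
  \<open>E0\<close>.\<close>

lemma admissible_extend_orthogonal:
  assumes E: "admissible E" and B: "finite B" "\<And>b u. b \<in> B \<Longrightarrow> u \<in> E0 \<Longrightarrow> inner b u = 0"
  obtains F where "admissible F" "E \<subseteq> F" "span F = span (E \<union> B)"
proof -
  obtain F where F: "finite F" "E \<subseteq> F" "orthonormal F" "span F = span (E \<union> B)"
    using orthonormal_extend[of B E] assms by (auto simp: admissible_def)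
  have "inner v u = 0" if "v \<in> span (E \<union> B)" "u \<in> E0" for u v
    using that(1)
  proof (induction rule: span_induct_alt)
    case (step c x y)
    then show ?case
      using E B(2) that(2) by (auto simp: inner_add_left admissible_def)
  qed simp
  then have "admissible F"
    using F span_superset[of F] unfolding admissible_def by blast
  then show ?thesis using F(2,4) that by blast
qed

lemma admissible_extend:
  fixes k :: nat and f :: "nat \<Rightarrow> 'a dual"
  assumes "admissible E"
  obtains F where "admissible F" "E \<subseteq> F" "\<forall>i<k. resid (f i) \<in> span F"
proof -
  let ?B = "resid ` f ` {..<k}"
  have B: "finite ?B" "\<And>b u. b \<in> ?B \<Longrightarrow> u \<in> E0 \<Longrightarrow> inner b u = 0"
    by (auto simp: resid_orthogonal span_base)
  obtain F where F: "admissible F" "E \<subseteq> F" "span F = span (E \<union> ?B)"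
    using admissible_extend_orthogonal[OF assms B] .
  have "resid (f i) \<in> span F" if "i < k" for i
    unfolding F(3) using that by (auto intro: span_base)
  then show ?thesis using that[OF F(1,2)] by simp
qed

text \<open>By Parseval the variance is the squared norm of the residual once \<open>span E\<close>
  contains it. That value does not mention \<open>E\<close>, which is the source of all consistency
  below.\<close>

lemma gauss_on_resolved_law:
  assumes "admissible E" "resid f \<in> span E"
  shows "distr (gauss_on E) borel (blinfun_apply f) = normal_law 0 ((norm (resid f))\<^sup>2)"
proof -
  have E: "finite E" "orthonormal E" using assms by (auto simp: admissible_def)
  have "(\<Sum>v\<in>E. (blinfun_apply f v)\<^sup>2) = (\<Sum>v\<in>E. (inner (resid f) v)\<^sup>2)"
    using assms(1) by (intro sum.cong refl) (simp add: inner_resid admissible_def)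
  also have "\<dots> = (norm (resid f))\<^sup>2"
    using norm_onb_proj[OF E, of "resid f"] onb_proj_span[OF E assms(2)] by simp
  finally show ?thesis using gauss_on_functional_law[OF E(1)] by simp
qed

text \<open>Residuals are linear, so both spans resolve every linear combination of the
  \<open>f i\<close>.\<close>

lemma gauss_on_coord_law_eq:
  assumes E: "admissible E" "\<And>i. i < k \<Longrightarrow> resid (f i) \<in> span E"
    and F: "admissible F" "\<And>i. i < k \<Longrightarrow> resid (f i) \<in> span F"
  shows "distr (gauss_on E) (borel_power k) (coord_map k f) = distr (gauss_on F) (borel_power k) (coord_map k f)"
proof (rule Cramer_Wold)
  fix a
  have lin: "resid (\<Sum>i<k. a i *\<^sub>R f i) = (\<Sum>i<k. a i *\<^sub>R resid (f i))"
    using linear_resid by (simp add: linear_sum linear_cmul)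
  then have "resid (\<Sum>i<k. a i *\<^sub>R f i) \<in> span E" "resid (\<Sum>i<k. a i *\<^sub>R f i) \<in> span F"
    using E(2) F(2) by (auto intro!: span_sum span_scale)
  then have "distr (gauss_on E) borel (blinfun_apply (\<Sum>i<k. a i *\<^sub>R f i)) =
      distr (gauss_on F) borel (blinfun_apply (\<Sum>i<k. a i *\<^sub>R f i))"
    using gauss_on_resolved_law E(1) F(1) by simp
  moreover have "(\<lambda>x. \<Sum>i<k. a i * x i) \<circ> coord_map k f = blinfun_apply (\<Sum>i<k. a i *\<^sub>R f i)"
    by (rule ext) (simp only: comp_apply coord_sum_coord_map)
  ultimately show "distr (distr (gauss_on E) (borel_power k) (coord_map k f)) borel (\<lambda>x. \<Sum>i<k. a i * x i) =
      distr (distr (gauss_on F) (borel_power k) (coord_map k f)) borel (\<lambda>x. \<Sum>i<k. a i * x i)"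
    by (simp add: distr_distr)
qed (auto intro!: prob_space.prob_space_distr prob_space_gauss_on)

text \<open>A cylinder set has many descriptions; it is enough that one of them uses only
  functionals with residuals in \<open>span E\<close>.\<close>

definition resolves :: "'a set \<Rightarrow> 'a set \<Rightarrow> bool" where
  "resolves E C \<longleftrightarrow> admissible E \<and>
     (\<exists>k f A. A \<in> sets (borel_power k) \<and> C = coord_map k f -` A \<and> (\<forall>i<k. resid (f i) \<in> span E))"

text \<open>The system is chosen anew for each cylinder set, as no single finite one need resolve
  them all; by \<open>gauss_on_resolved_eq\<close> the choice is immaterial.\<close>

definition residual_law :: "'a set \<Rightarrow> ennreal" where
  "residual_law = (\<lambda>C\<in>cylinder_sets. emeasure (gauss_on (SOME E. resolves E C)) C)"

text \<open>The two systems may resolve \<open>C\<close> through different descriptions. An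
  extension \<open>H\<close> of \<open>E\<close> that also resolves the second one is compared with
  \<open>E\<close> over \<open>f\<close> and with \<open>F\<close> over \<open>g\<close>.\<close>

lemma gauss_on_resolved_eq:
  assumes "resolves E C" "resolves F C"
  shows "emeasure (gauss_on E) C = emeasure (gauss_on F) C"
proof -
  from assms(1) obtain k f A where A: "A \<in> sets (borel_power k)" "C = coord_map k f -` A"
    and E: "admissible E" "\<And>i. i < k \<Longrightarrow> resid (f i) \<in> span E"
    by (auto simp: resolves_def)
  from assms(2) obtain l g B where B: "B \<in> sets (borel_power l)" "C = coord_map l g -` B"
    and F: "admissible F" "\<And>i. i < l \<Longrightarrow> resid (g i) \<in> span F"
    by (auto simp: resolves_def)
  obtain H where H: "admissible H" "E \<subseteq> H" "\<forall>i<l. resid (g i) \<in> span H"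
    using admissible_extend[OF E(1), of l g] .
  have "distr (gauss_on E) (borel_power k) (coord_map k f) = distr (gauss_on H) (borel_power k) (coord_map k f)"
    using E H span_mono[OF H(2)] by (intro gauss_on_coord_law_eq) auto
  then have "emeasure (distr (gauss_on E) (borel_power k) (coord_map k f)) A =
    emeasure (distr (gauss_on H) (borel_power k) (coord_map k f)) A" by simp
  then have "emeasure (gauss_on E) C = emeasure (gauss_on H) C"
    using A by (simp add: emeasure_distr)
  moreover have "distr (gauss_on F) (borel_power l) (coord_map l g) = distr (gauss_on H) (borel_power l) (coord_map l g)"
    using F H by (intro gauss_on_coord_law_eq) auto
  then have "emeasure (distr (gauss_on F) (borel_power l) (coord_map l g)) B =
    emeasure (distr (gauss_on H) (borel_power l) (coord_map l g)) B" by simp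
  then have "emeasure (gauss_on F) C = emeasure (gauss_on H) C"
    using B by (simp add: emeasure_distr)
  ultimately show ?thesis by simp
qed

lemma residual_law_eq:
  assumes "resolves E C"
  shows "residual_law C = emeasure (gauss_on E) C"
proof -
  have "C \<in> cylinder_sets" using assms by (auto simp: resolves_def cylinder_sets_def)
  then show ?thesis
    unfolding residual_law_def using assms gauss_on_resolved_eq[OF someI[of "\<lambda>E. resolves E C"]] by simp
qed

lemma admissible_empty: "admissible {}"
  by (simp add: admissible_def orthonormal_def)

text \<open>One \<open>E\<close> resolves all cylinder sets over the tuple \<open>f\<close>, so the
  whole push-forward comes from one measure. The factor \<open>L\<close> lets this serve tuples,
  single functionals and finite-rank maps alike.\<close>

lemma pushforward_residual_law:
  assumes L: "L \<in> borel_power k \<rightarrow>\<^sub>M N" and F: "\<And>x. F x = L (coord_map k f x)"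
    and E: "admissible E" "\<And>i. i < k \<Longrightarrow> resid (f i) \<in> span E"
  shows "pushforward N F residual_law = distr (gauss_on E) N F"
proof (rule pushforward_eqI)
  fix A assume A: "A \<in> sets N"
  have "F -` A = coord_map k f -` (L -` A \<inter> space (borel_power k))"
    using F coord_map_in_space by auto
  then have "resolves E (F -` A)"
    unfolding resolves_def using E measurable_sets[OF L A] by blast
  moreover have "F \<in> borel \<rightarrow>\<^sub>M N"
    unfolding F[abs_def] by (intro measurable_compose[OF _ L]) simp
  ultimately show "residual_law (F -` A) = emeasure (distr (gauss_on E) N F) A"
    using A by (simp add: residual_law_eq emeasure_distr)
qed simp

text \<open>Additivity on two cylinder sets is additivity of one Gaussian measure that resolves both
  and their union.\<close>

lemma residual_law_in_CM: "residual_law \<in> CM"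
proof -
  have "additive cylinder_sets residual_law"
    unfolding additive_def
  proof safe
    fix C D :: "'a set"
    assume CD: "C \<in> cylinder_sets" "D \<in> cylinder_sets" "C \<inter> D = {}"
    obtain k f A B where A: "A \<in> sets (borel_power k)" "C = coord_map k f -` A"
      and B: "B \<in> sets (borel_power k)" "D = coord_map k f -` B"
      using cylinder_sets_common_coordinates[OF CD(1,2)] .
    obtain E where E: "admissible E" "{} \<subseteq> E" "\<forall>i<k. resid (f i) \<in> span E"
      using admissible_extend[OF admissible_empty, of k f] .
    have "C \<union> D = coord_map k f -` (A \<union> B)" using A B by auto
    then have "resolves E C" "resolves E D" "resolves E (C \<union> D)"
      unfolding resolves_def using A B E by blast+
    moreover have "C \<in> sets borel" "D \<in> sets borel"
      using measurable_sets[OF measurable_coord_map A(1), of f] measurable_sets[OF measurable_coord_map B(1), of f] A B by auto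
    ultimately show "residual_law (C \<union> D) = residual_law C + residual_law D"
      using CD(3) by (simp add: residual_law_eq plus_emeasure)
  qed
  moreover have "positive cylinder_sets residual_law"
  proof -
    have "resolves {} {}"
      unfolding resolves_def using admissible_empty by (auto intro!: exI[of _ 0] exI[of _ "{}"])
    then show ?thesis by (simp add: positive_def residual_law_eq)
  qed
  moreover have "prob_space (pushforward (borel_power k) (coord_map k f) residual_law)" for k f
  proof -
    obtain E where E: "admissible E" "{} \<subseteq> E" "\<forall>i<k. resid (f i) \<in> span E"
      using admissible_extend[OF admissible_empty, of k f] .
    then have "pushforward (borel_power k) (coord_map k f) residual_law =
      distr (gauss_on E) (borel_power k) (coord_map k f)"
      by (intro pushforward_residual_law[where L = "\<lambda>x. x"]) auto
    then show ?thesis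
      by (simp add: prob_space.prob_space_distr prob_space_gauss_on)
  qed
  ultimately show ?thesis
    by (simp add: CM_def residual_law_def)
qed

lemma pushforward_functional_residual_law:
  "pushforward borel (blinfun_apply f) residual_law = normal_law 0 ((norm (resid f))\<^sup>2)"
proof -
  obtain E where "admissible E" "{} \<subseteq> E" "\<forall>i<1::nat. resid f \<in> span E"
    using admissible_extend[OF admissible_empty, of 1 "\<lambda>_. f"] .
  then have E: "admissible E" "resid f \<in> span E" by simp_all
  have "pushforward borel (blinfun_apply f) residual_law = distr (gauss_on E) borel (blinfun_apply f)"
    by (rule pushforward_residual_law[where L = "\<lambda>x. x 0" and k = 1 and f = "\<lambda>_. f"])
      (simp_all add: E)
  then show ?thesis using gauss_on_resolved_law[OF E] by simp
qed

lemma gaussian_cylinder_measure_eq_residual_law: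
  assumes "\<And>f. blinfun_apply f (blinfun_apply T f) = (norm (resid f))\<^sup>2"
  shows "gaussian_cylinder_measure T = residual_law"
proof -
  have *: "is_gaussian_cylinder_measure T residual_law"
    using assms by (simp add: is_gaussian_cylinder_measure_def residual_law_in_CM
        pushforward_functional_residual_law)
  show ?thesis
    unfolding gaussian_cylinder_measure_def
    by (rule the_equality, rule *) (rule gaussian_cylinder_measure_unique[OF _ *])
qed

end

section \<open>Approximation by Gaussian measures\<close>

text \<open>The \<open>g i\<close> are the coordinates of \<open>F x\<close> in an orthonormal basis
  of a finite-dimensional space containing the range.\<close>

lemma finite_rank_coordinates:
  fixes F :: "'a::{real_inner, polish_space} \<Rightarrow>\<^sub>L 'a"
  assumes "finite_dim (range (blinfun_apply F))"
  obtains k :: nat and g :: "nat \<Rightarrow> 'a dual" and L :: "(nat \<Rightarrow> real) \<Rightarrow> 'a"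
  where "L \<in> borel_power k \<rightarrow>\<^sub>M borel" "\<And>x. blinfun_apply F x = L (coord_map k g x)"
    "\<And>x. (norm (blinfun_apply F x))\<^sup>2 = (\<Sum>i<k. (blinfun_apply (g i) x)\<^sup>2)"
proof -
  obtain B where B: "finite B" "range (blinfun_apply F) \<subseteq> span B"
    using assms by (auto simp: finite_dim_def)
  obtain E where E: "finite E" "orthonormal E" "span E = span B"
    using orthonormal_extend[OF B(1), of "{}"] by (auto simp: orthonormal_def)
  obtain b where b: "bij_betw b {..<card E} E"
    using ex_bij_betw_nat_finite[OF E(1)] by (auto simp: atLeast0LessThan)
  define g where "g i = blinfun_inner_right (b i) o\<^sub>L F" for i
  define L where "L y = (\<Sum>i<card E. y i *\<^sub>R b i)" for y :: "nat \<Rightarrow> real"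
  have proj: "onb_proj E (blinfun_apply F x) = blinfun_apply F x" for x
    using B(2) E by (intro onb_proj_span) auto
  have "L \<in> borel_power (card E) \<rightarrow>\<^sub>M borel"
    unfolding L_def by (intro borel_measurable_sum borel_measurable_scaleR borel_measurable_const measurable_component_singleton)
  moreover have "blinfun_apply F x = L (coord_map (card E) g x)" for x
  proof -
    have "blinfun_apply F x = (\<Sum>v\<in>E. inner (blinfun_apply F x) v *\<^sub>R v)"
      using proj[of x] by (simp add: onb_proj_def)
    also have "\<dots> = (\<Sum>i<card E. inner (blinfun_apply F x) (b i) *\<^sub>R b i)"
      using sum.reindex_bij_betw[OF b, of "\<lambda>v. inner (blinfun_apply F x) v *\<^sub>R v"] by simp
    finally show ?thesis by (simp add: L_def g_def inner_commute)
  qed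
  moreover have "(norm (blinfun_apply F x))\<^sup>2 = (\<Sum>i<card E. (blinfun_apply (g i) x)\<^sup>2)" for x
  proof -
    have "(norm (blinfun_apply F x))\<^sup>2 = (\<Sum>v\<in>E. (inner (blinfun_apply F x) v)\<^sup>2)"
      using norm_onb_proj[OF E(1,2), of "blinfun_apply F x"] proj[of x] by simp
    also have "\<dots> = (\<Sum>i<card E. (inner (blinfun_apply F x) (b i))\<^sup>2)"
      using sum.reindex_bij_betw[OF b, of "\<lambda>v. (inner (blinfun_apply F x) v)\<^sup>2"] by simp
    finally show ?thesis by (simp add: g_def inner_commute)
  qed
  ultimately show ?thesis using that by blast
qed

lemma onb_residual_minimal:
  assumes "finite E" "orthonormal E" "y \<in> span E"
  shows "norm (x - onb_proj E x) \<le> norm (x - y)"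
proof -
  have "(norm (x - onb_proj E x))\<^sup>2 \<le> (norm (x - y))\<^sup>2"
    using norm_pythagoras_onb_proj[OF assms, of x] by simp
  then show ?thesis by simp
qed

text \<open>Vectors of \<open>H - E\<close> are orthogonal to \<open>span E\<close>, so they see
  only the residual of \<open>y\<close>, to which Bessel applies.\<close>

lemma sum_inner_outside:
  assumes "finite H" "orthonormal H" "E \<subseteq> H"
  shows "(\<Sum>v\<in>H - E. (inner y v)\<^sup>2) \<le> (norm (y - onb_proj E y))\<^sup>2"
proof -
  have E: "finite E" using assms finite_subset by blast
  have "inner (onb_proj E y) v = 0" if "v \<in> H - E" for v
  proof -
    have "inner u v = 0" if "u \<in> E" for u
      using assms(2,3) that \<open>v \<in> H - E\<close> unfolding orthonormal_def by (metis DiffD1 DiffD2 subsetD)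
    then show ?thesis by (simp add: onb_proj_def inner_sum_left)
  qed
  then have "(\<Sum>v\<in>H - E. (inner y v)\<^sup>2) = (\<Sum>v\<in>H - E. (inner (y - onb_proj E y) v)\<^sup>2)"
    by (intro sum.cong refl) (simp add: inner_diff_left)
  also have "\<dots> \<le> (norm (y - onb_proj E y))\<^sup>2"
    by (rule Bessel) (use assms orthonormal_subset[of H "H - E"] in auto)
  finally show ?thesis .
qed

text \<open>The cross term vanishes because the noise has mean 0. The shift \<open>c\<close> is the
  constant value of a recovery map in the numerator of the loss, and 0 in the denominator.\<close>

lemma gauss_on_second_moment:
  fixes E :: "'a::{real_inner, polish_space} set"
  assumes "finite E" "orthonormal E"
  shows "(\<integral>\<^sup>+x. ennreal ((norm (x - c))\<^sup>2) \<partial>gauss_on E) = ennreal (real (card E) + (norm c)\<^sup>2)"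
proof -
  have eq: "(norm (noise_sum E z - c))\<^sup>2 =
    (norm (\<Sum>v\<in>E. z v *\<^sub>R v))\<^sup>2 - 2 * (\<Sum>v\<in>E. inner v c * z v) + (norm c)\<^sup>2" for z
  proof -
    have "inner (noise_sum E z) c = (\<Sum>v\<in>E. inner v c * z v)"
      by (simp add: noise_sum_def inner_sum_left mult.commute)
    moreover have "(norm (noise_sum E z - c))\<^sup>2 = (norm (noise_sum E z))\<^sup>2 - 2 * inner (noise_sum E z) c + (norm c)\<^sup>2"
      unfolding power2_norm_eq_inner by (simp add: inner_diff_left inner_diff_right inner_commute)
    ultimately show ?thesis by (simp add: noise_sum_def)
  qed
  note m2 = white_noise_sum_second_moment[OF assms(1), of "\<lambda>v. v"]
  have i1: "integrable white_noise (\<lambda>z. \<Sum>v\<in>E. inner v c * z v)"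
    by (intro Bochner_Integration.integrable_sum integrable_mult_right white_noise_mean)
  have i2: "(\<integral>z. (\<Sum>v\<in>E. inner v c * z v) \<partial>white_noise) = 0"
    by (simp add: Bochner_Integration.integral_sum white_noise_mean)
  have "norm v = 1" if "v \<in> E" for v
    using assms(2) that by (auto simp: orthonormal_def norm_eq_1)
  then have card: "(\<Sum>v\<in>E. (norm v)\<^sup>2) = real (card E)" by simp
  have int: "integrable white_noise (\<lambda>z. (norm (noise_sum E z - c))\<^sup>2)"
    unfolding eq using m2(1) i1
    by (intro Bochner_Integration.integrable_add Bochner_Integration.integrable_diff integrable_mult_right) auto
  have val: "(\<integral>z. (norm (noise_sum E z - c))\<^sup>2 \<partial>white_noise) = real (card E) + (norm c)\<^sup>2"
    unfolding eq using m2 i1 i2 card by (simp add: white_noise.prob_space[simplified])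
  have "(\<integral>\<^sup>+x. ennreal ((norm (x - c))\<^sup>2) \<partial>gauss_on E) =
      (\<integral>\<^sup>+z. ennreal ((norm (noise_sum E z - c))\<^sup>2) \<partial>white_noise)"
    unfolding gauss_on_def by (subst nn_integral_distr) auto
  also have "\<dots> = ennreal (real (card E) + (norm c)\<^sup>2)"
    using nn_integral_eq_integral[OF int] val by simp
  finally show ?thesis .
qed

lemma gauss_on_in_M2:
  assumes "finite E" "orthonormal E" "E \<noteq> {}"
  shows "gauss_on E \<in> M2"
  using gauss_on_second_moment[OF assms(1,2), of 0] prob_space_gauss_on[of E] assms
  by (simp add: M2_def card_gt_0_iff)

lemma gaussian_measure_gauss_on:
  assumes "finite E"
  shows "gaussian_measure (gauss_on E)"
  unfolding gaussian_measure_def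
proof (intro conjI allI)
  fix f :: "'a dual"
  have "0 \<le> (\<Sum>v\<in>E. (blinfun_apply f v)\<^sup>2)" by (intro sum_nonneg) simp
  then show "\<exists>m v. 0 \<le> v \<and> distr (gauss_on E) borel (blinfun_apply f) = normal_law m v"
    using gauss_on_functional_law[OF assms] by blast
qed (auto intro: prob_space_gauss_on)

context gaussian_residual
begin

text \<open>Gram-Schmidt on \<open>w\<close> and the first \<open>n\<close> projected members of a
  countable dense set. Each \<open>E n\<close> is chosen separately, so only the spans increase;
  this suffices because the residual norm is the distance to the span. The vector \<open>w\<close>
  keeps every \<open>E n\<close> nonempty.\<close>

lemma dense_admissible_sequence:
  assumes w: "w \<noteq> 0" "\<And>u. u \<in> E0 \<Longrightarrow> inner w u = 0"
  obtains E :: "nat \<Rightarrow> 'a set" where "\<And>n. admissible (E n)" "\<And>n. E n \<noteq> {}"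
    "\<And>y. (\<And>u. u \<in> E0 \<Longrightarrow> inner y u = 0) \<Longrightarrow> (\<lambda>n. norm (y - onb_proj (E n) y)) \<longlonglongrightarrow> 0"
proof -
  obtain D :: "'a set" where D: "countable D" "\<forall>X. open X \<longrightarrow> X \<noteq> {} \<longrightarrow> (\<exists>d\<in>D. d \<in> X)"
    by (rule exE[OF countable_dense_exists]) (elim conjE, rule that)
  have "D \<noteq> {}" using D(2) open_UNIV by blast
  define d where "d = from_nat_into D"
  have d: "range d = D" unfolding d_def by (rule range_from_nat_into[OF \<open>D \<noteq> {}\<close> D(1)])
  define p where "p x = x - onb_proj E0 x" for x
  have p_orth: "inner (p x) u = 0" if "u \<in> E0" for x u
    unfolding p_def by (rule inner_residual_span[OF E0 span_base[OF that]])
  have p_norm: "norm (p x) \<le> norm x" for x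
    using onb_residual_minimal[OF E0 span_zero, of x] by (simp add: p_def)
  have "\<exists>F. admissible F \<and> span F = span (insert w ((\<lambda>j. p (d j)) ` {..<n}))" for n
  proof -
    let ?B = "insert w ((\<lambda>j. p (d j)) ` {..<n})"
    have B: "finite ?B" "\<And>b u. b \<in> ?B \<Longrightarrow> u \<in> E0 \<Longrightarrow> inner b u = 0"
      using w(2) p_orth by auto
    obtain F where "admissible F" "{} \<subseteq> F" "span F = span ({} \<union> ?B)"
      using admissible_extend_orthogonal[OF admissible_empty B] .
    then show ?thesis by auto
  qed
  then obtain E where E: "\<And>n. admissible (E n)"
    "\<And>n. span (E n) = span (insert w ((\<lambda>j. p (d j)) ` {..<n}))"
    by metis
  have "E n \<noteq> {}" for n
  proof
    assume "E n = {}"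
    then have "w \<in> span {}" using E(2)[of n] span_base[of w "insert w ((\<lambda>j. p (d j)) ` {..<n})"] by simp
    then show False using w(1) by simp
  qed
  moreover have "(\<lambda>n. norm (y - onb_proj (E n) y)) \<longlonglongrightarrow> 0" if y: "\<And>u. u \<in> E0 \<Longrightarrow> inner y u = 0" for y
  proof (rule LIMSEQ_I)
    fix r :: real assume "r > 0"
    then obtain j where j: "dist y (d j) < r"
      using D(2)[rule_format, of "ball y r"] unfolding d[symmetric] by (auto simp: mem_ball)
    \<comment> \<open>The projection \<open>p\<close> fixes \<open>y\<close> and does not increase
      norms, so \<open>p (d j)\<close> is as close to \<open>y\<close> as required of
      \<open>d j\<close>.\<close>
    have "onb_proj E0 y = 0" using y by (simp add: onb_proj_def)
    then have "p y = y" by (simp add: p_def)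
    then have "norm (y - p (d j)) = norm (p (y - d j))"
      by (simp add: p_def linear_diff[OF linear_onb_proj] algebra_simps)
    also have "\<dots> < r" using p_norm[of "y - d j"] j by (simp add: dist_norm)
    finally have "norm (y - p (d j)) < r" .
    moreover have "norm (y - onb_proj (E n) y) \<le> norm (y - p (d j))" if "n > j" for n
    proof (rule onb_residual_minimal)
      show "p (d j) \<in> span (E n)" unfolding E(2) using that by (intro span_base) auto
    qed (use E(1)[of n] in \<open>auto simp: admissible_def\<close>)
    ultimately show "\<exists>N. \<forall>n\<ge>N. norm (norm (y - onb_proj (E n) y) - 0) < r"
      by (intro exI[of _ "Suc j"]) (simp, meson le_less_trans Suc_le_lessD)
  qed
  ultimately show ?thesis by (rule that[OF E(1)])
qed

text \<open>\<open>gauss_on (E n)\<close> and the limit law are coupled by drawing both from the same white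
  noise: the limit uses an extension \<open>H n\<close> of \<open>E n\<close> that resolves the
  coordinates of \<open>F\<close>.\<close>

lemma cylinder_converges_gauss_on:
  assumes E: "\<And>n. admissible (E n)"
    and dense: "\<And>y. (\<And>u. u \<in> E0 \<Longrightarrow> inner y u = 0) \<Longrightarrow> (\<lambda>n. norm (y - onb_proj (E n) y)) \<longlonglongrightarrow> 0"
  shows "cylinder_converges (\<lambda>n. cylinder_of (gauss_on (E n))) residual_law"
  unfolding cylinder_converges_def
proof safe
  fix F :: "'a \<Rightarrow>\<^sub>L 'a"
  assume "finite_dim (range (blinfun_apply F))"
  then obtain k g L where L: "L \<in> borel_power k \<rightarrow>\<^sub>M borel" "\<And>x. blinfun_apply F x = L (coord_map k g x)"
    and norm_F: "\<And>x. (norm (blinfun_apply F x))\<^sup>2 = (\<Sum>i<k. (blinfun_apply (g i) x)\<^sup>2)"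
    by (rule finite_rank_coordinates) blast
  have "\<exists>H. admissible H \<and> E n \<subseteq> H \<and> (\<forall>i<k. resid (g i) \<in> span H)" for n
    using admissible_extend[OF E[of n], of k g] by metis
  then obtain H where H: "\<And>n. admissible (H n)" "\<And>n. E n \<subseteq> H n" "\<And>n i. i < k \<Longrightarrow> resid (g i) \<in> span (H n)"
    by metis
  define X where "X n z = blinfun_apply F (noise_sum (E n) z)" for n z
  define Y where "Y n z = blinfun_apply F (noise_sum (H n) z)" for n z
  have [measurable]: "X n \<in> borel_measurable white_noise" "Y n \<in> borel_measurable white_noise" for n
    unfolding X_def Y_def by measurable
  have limit: "distr white_noise borel (Y n) = pushforward borel (blinfun_apply F) residual_law" for n
    using pushforward_residual_law[OF L H(1,3), of n]
    by (simp add: gauss_on_def distr_distr comp_def Y_def[abs_def])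
  have approx: "pushforward borel (blinfun_apply F) (cylinder_of (gauss_on (E n))) = distr white_noise borel (X n)" for n
    using pushforward_cylinder_of[OF L(1) _ L(2), of "gauss_on (E n)"]
    by (simp add: gauss_on_def distr_distr comp_def X_def[abs_def])
  \<comment> \<open>Squared distances from the finitely many residuals seen by \<open>F\<close> to
    \<open>span (E n)\<close>; they bound the mean square distance of \<open>X n\<close> and
    \<open>Y n\<close>, and Markov's inequality does the rest.\<close>
  define s where "s n = (\<Sum>i<k. (norm (resid (g i) - onb_proj (E n) (resid (g i))))\<^sup>2)" for n
  have s: "s \<longlonglongrightarrow> 0"
  proof -
    have "(\<lambda>n. \<Sum>i<k. (norm (resid (g i) - onb_proj (E n) (resid (g i))))\<^sup>2) \<longlonglongrightarrow> (\<Sum>i<k. 0\<^sup>2)"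
      by (intro tendsto_sum tendsto_power dense resid_orthogonal span_base)
    then show ?thesis by (simp add: s_def[abs_def])
  qed
  have dist: "dist (X n z) (Y n z) = norm (\<Sum>v\<in>H n - E n. z v *\<^sub>R blinfun_apply F v)" for n z
  proof -
    have "noise_sum (H n) z - noise_sum (E n) z = (\<Sum>v\<in>H n - E n. z v *\<^sub>R v)"
      using H(1,2)[of n] by (simp add: noise_sum_def admissible_def sum_diff)
    then have "Y n z - X n z = (\<Sum>v\<in>H n - E n. z v *\<^sub>R blinfun_apply F v)"
      by (simp add: X_def Y_def blinfun.diff_right[symmetric] blinfun.sum_right blinfun.scaleR_right)
    then show ?thesis using norm_minus_commute[of "X n z" "Y n z"] by (simp add: dist_norm)
  qed
  have fin: "finite (H n - E n)" for n using H(1)[of n] by (simp add: admissible_def)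
  note m2 = white_noise_sum_second_moment[OF fin, where w = "blinfun_apply F", folded dist]
  have bound: "(\<integral>z. (dist (X n z) (Y n z))\<^sup>2 \<partial>white_noise) \<le> s n" for n
  proof -
    \<comment> \<open>The coordinates in \<open>E n\<close> have cancelled. On each remaining
      \<open>v\<close> the functional \<open>g i\<close> acts through its residual, which prepares
      the Bessel bound for every \<open>i\<close> separately.\<close>
    have "(\<integral>z. (dist (X n z) (Y n z))\<^sup>2 \<partial>white_noise) = (\<Sum>v\<in>H n - E n. \<Sum>i<k. (inner (resid (g i)) v)\<^sup>2)"
      unfolding m2 norm_F using H(1)[of n]
      by (intro sum.cong refl) (simp add: inner_resid admissible_def)
    also have "\<dots> = (\<Sum>i<k. \<Sum>v\<in>H n - E n. (inner (resid (g i)) v)\<^sup>2)"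
      by (rule sum.swap)
    also have "\<dots> \<le> s n"
      unfolding s_def using H(1,2)[of n] by (intro sum_mono sum_inner_outside) (auto simp: admissible_def)
    finally show ?thesis .
  qed
  have "weakly_converges (\<lambda>n. distr white_noise borel (X n)) (pushforward borel (blinfun_apply F) residual_law)"
  proof (rule weakly_converges_coupling[OF white_noise.prob_space_axioms _ _ limit])
    fix d :: real assume d: "d > 0"
    have "measure white_noise {z\<in>space white_noise. d \<le> dist (X n z) (Y n z)} \<le> s n / d\<^sup>2" for n
    proof -
      have "{z\<in>space white_noise. d \<le> dist (X n z) (Y n z)} = {z\<in>space white_noise. d\<^sup>2 \<le> (dist (X n z) (Y n z))\<^sup>2}"
        using d by simp
      also have "measure white_noise \<dots> \<le> (\<integral>z. (dist (X n z) (Y n z))\<^sup>2 \<partial>white_noise) / d\<^sup>2"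
        by (rule integral_Markov_inequality_measure[OF m2(1), of "{}"]) (use d in auto)
      also have "\<dots> \<le> s n / d\<^sup>2" by (rule divide_right_mono[OF bound]) simp
      finally show ?thesis .
    qed
    note le = this
    have "(\<lambda>n. s n / d\<^sup>2) \<longlonglongrightarrow> 0 / d\<^sup>2" by (intro tendsto_divide s tendsto_const) (use d in simp)
    then have lim: "(\<lambda>n. s n / d\<^sup>2) \<longlonglongrightarrow> 0" by simp
    show "(\<lambda>n. measure white_noise {z\<in>space white_noise. d \<le> dist (X n z) (Y n z)}) \<longlonglongrightarrow> 0"
    proof (rule tendsto_sandwich[OF _ _ tendsto_const lim])
      show "\<forall>\<^sub>F n in sequentially. measure white_noise {z\<in>space white_noise. d \<le> dist (X n z) (Y n z)} \<le> s n / d\<^sup>2"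
        using le by (rule always_eventually[OF allI])
    qed (simp add: measure_nonneg)
  qed auto
  then show "weakly_converges (\<lambda>n. pushforward borel (blinfun_apply F) (cylinder_of (gauss_on (E n))))
      (pushforward borel (blinfun_apply F) residual_law)"
    by (simp add: approx)
qed

end

section \<open>The game\<close>

text \<open>No set of a generated \<sigma>-algebra separates two points that the generators do not
  separate; this applies to the preimage of the closed set \<open>{v 0}\<close>.\<close>

lemma recovery_maps_eq_at_zero:
  fixes v :: "'a::real_normed_vector \<Rightarrow> 'a"
  assumes v: "v \<in> recovery_maps G" and x: "\<And>f. f \<in> G \<Longrightarrow> blinfun_apply f x = 0"
  shows "v x = v 0"
proof -
  let ?S = "{blinfun_apply f -` A | f A. f \<in> G \<and> A \<in> sets borel}"
  have S: "?S \<subseteq> Pow UNIV" by auto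
  have "v -` {v 0} \<inter> space (sigma UNIV ?S) \<in> sets (sigma UNIV ?S)"
    using v unfolding recovery_maps_def by (rule measurable_sets) simp
  then have "v -` {v 0} \<in> sigma_sets UNIV ?S" by (simp add: S)
  moreover have "0 \<in> C \<longleftrightarrow> x \<in> C" if "C \<in> sigma_sets UNIV ?S" for C
    using that by (induction rule: sigma_sets.induct) (auto simp: x)
  ultimately have "x \<in> v -` {v 0}" by blast
  then show ?thesis by simp
qed

lemma functional_recovery_measurable:
  fixes G :: "'a::real_normed_vector dual set"
  assumes "f \<in> span G"
  shows "blinfun_apply f \<in> borel_measurable (sigma UNIV {blinfun_apply f -` A | f A. f \<in> G \<and> A \<in> sets borel})"
    (is "_ \<in> borel_measurable ?N")
  using assms
proof (induction rule: span_induct_alt)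
  case base
  then show ?case by simp
next
  case (step c f g)
  have S: "{blinfun_apply f -` A | f A. f \<in> G \<and> A \<in> sets borel} \<subseteq> Pow UNIV" by auto
  have "blinfun_apply f \<in> borel_measurable ?N"
  proof (rule measurableI)
    fix A :: "real set" assume "A \<in> sets borel"
    then have "blinfun_apply f -` A \<in> {blinfun_apply f -` A | f A. f \<in> G \<and> A \<in> sets borel}"
      using step(1) by blast
    then show "blinfun_apply f -` A \<inter> space ?N \<in> sets ?N" by (simp add: S)
  qed simp
  moreover have "blinfun_apply (c *\<^sub>R f + g) = (\<lambda>x. c * blinfun_apply f x + blinfun_apply g x)"
    by (auto simp: blinfun.add_left blinfun.scaleR_left)
  ultimately show ?case using step(2) by simp
qed

section \<open>Uniqueness of the short\<close>

lemma polarization_symmetric_op: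
  fixes S T :: "'a::real_normed_vector dual \<Rightarrow>\<^sub>L 'a" and f g :: "'a dual"
  assumes "symmetric_op S" "symmetric_op T"
    and "\<And>f. blinfun_apply f (blinfun_apply S f) = blinfun_apply f (blinfun_apply T f)"
  shows "blinfun_apply f (blinfun_apply S g) = blinfun_apply f (blinfun_apply T g)"
proof -
  have "blinfun_apply f (blinfun_apply R g) = (blinfun_apply (f + g) (blinfun_apply R (f + g))
      - blinfun_apply f (blinfun_apply R f) - blinfun_apply g (blinfun_apply R g)) / 2"
    if "symmetric_op R" for R :: "'a dual \<Rightarrow>\<^sub>L 'a"
  proof -
    have "blinfun_apply g (blinfun_apply R f) = blinfun_apply f (blinfun_apply R g)"
      using that by (simp add: symmetric_op_def)
    then show ?thesis by (simp add: blinfun.add_left blinfun.add_right)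
  qed
  from this[OF assms(1)] this[OF assms(2)] show ?thesis by (simp only: assms(3))
qed

text \<open>The infimum prescribes only the quadratic form; symmetry recovers the bilinear form by
  polarization, and inner products separate vectors.\<close>

lemma is_short_unique:
  fixes Q :: "'a::real_inner dual \<Rightarrow>\<^sub>L 'a"
  assumes "is_short Q \<Phi> S" "is_short Q \<Phi> T"
  shows "S = T"
proof (rule blinfun_eqI)
  fix g
  have "inner u (blinfun_apply S g) = inner u (blinfun_apply T g)" for u
    using polarization_symmetric_op[of S T "blinfun_inner_right u" g] assms by (simp add: is_short_def)
  then show "blinfun_apply S g = blinfun_apply T g"
    by (subst vector_eq_ldot[symmetric]) blast
qed

text \<open>Membership in \<open>M2\<close> keeps the denominator away from 0 and infinity, so its
  quotient by itself is 1.\<close>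

lemma Psi_le_one:
  assumes "\<mu> \<in> M2" "\<And>x. norm (x - v x) \<le> norm x"
  shows "Psi v \<mu> \<le> 1"
proof -
  let ?d = "\<integral>\<^sup>+x. ennreal ((norm x)\<^sup>2) \<partial>\<mu>"
  have "(\<integral>\<^sup>+x. ennreal ((norm (x - v x))\<^sup>2) \<partial>\<mu>) \<le> ?d"
    by (intro nn_integral_mono ennreal_leI power_mono assms) simp
  then have "(\<integral>\<^sup>+x. ennreal ((norm (x - v x))\<^sup>2) \<partial>\<mu>) / ?d \<le> ?d / ?d"
    by (rule divide_right_mono_ennreal)
  also have "\<dots> = 1"
    using assms(1) by (intro ennreal_divide_self) (auto simp: M2_def less_top)
  finally show ?thesis
    unfolding Psi_def less_eq_ennreal.rep_eq one_ennreal.rep_eq .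
qed

context gaussian_residual
begin

text \<open>Symmetry holds because \<open>[f, resid g]\<close> is the inner product of the two
  residuals.\<close>

lemma symmetric_residual_operator:
  obtains T where "symmetric_op T" "\<forall>f. blinfun_apply T f = resid f"
proof -
  have "bounded_linear resid"
    unfolding resid_def[abs_def] onb_proj_def
    by (intro bounded_linear_sub bounded_linear_sum bounded_linear_scaleR_const
        bounded_linear_compose[OF bounded_linear_inner_left] blinfun.bounded_linear_right)
  then have T: "blinfun_apply (Blinfun resid) f = resid f" for f
    by (simp add: bounded_linear_Blinfun_apply)
  have "blinfun_apply f (resid g) = inner (resid f) (resid g)" for f g
    using inner_resid[of "resid g" f] resid_orthogonal[OF span_base] by simp
  then have "symmetric_op (Blinfun resid)"
    unfolding symmetric_op_def T by (simp add: inner_commute)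
  then show ?thesis using that T by blast
qed

lemma apply_resid: "blinfun_apply f (resid f) = (norm (resid f))\<^sup>2"
  using inner_resid[of "resid f" f] resid_orthogonal[OF span_base] by (simp add: power2_norm_eq_inner)

text \<open>The infimum is the squared distance from \<open>Q s\<close> to \<open>span E0\<close>,
  attained where \<open>Q t0\<close> cancels the projection of \<open>Q s\<close>. So the residual
  operator is a short, and uniqueness resolves the definite description.\<close>

lemma short_quadratic_form:
  assumes \<Phi>: "blinfun_apply Q ` \<Phi> = span E0"
  shows "blinfun_apply f (blinfun_apply (short Q \<Phi>) f) = (norm (resid f))\<^sup>2"
proof -
  obtain T where T: "symmetric_op T" "\<forall>f. blinfun_apply T f = resid f"
    using symmetric_residual_operator .
  have "(norm (resid s))\<^sup>2 = (INF t\<in>\<Phi>. blinfun_apply (s + t) (blinfun_apply Q (s + t)))" for s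
  proof -
    \<comment> \<open>The double minus exhibits a distance to the point \<open>- Q t\<close> of the
      span, the shape that \<open>onb_residual_minimal\<close> expects.\<close>
    have form: "blinfun_apply (s + t) (blinfun_apply Q (s + t)) = (norm (blinfun_apply Q s - - blinfun_apply Q t))\<^sup>2" for t
      by (simp only: riesz[of "s + t"] power2_norm_eq_inner blinfun.add_right diff_minus_eq_add inner_add_right)
    have "- onb_proj E0 (blinfun_apply Q s) \<in> blinfun_apply Q ` \<Phi>"
      unfolding \<Phi> by (intro span_neg onb_proj_in_span)
    then obtain t0 where t0: "t0 \<in> \<Phi>" "blinfun_apply Q t0 = - onb_proj E0 (blinfun_apply Q s)"
      by (metis imageE)
    have "(INF t\<in>\<Phi>. blinfun_apply (s + t) (blinfun_apply Q (s + t))) = (norm (resid s))\<^sup>2"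
    proof (rule cInf_eq_minimum)
      show "(norm (resid s))\<^sup>2 \<in> (\<lambda>t. blinfun_apply (s + t) (blinfun_apply Q (s + t))) ` \<Phi>"
        using t0 by (intro image_eqI[OF _ t0(1)]) (simp add: form resid_def)
      fix y assume "y \<in> (\<lambda>t. blinfun_apply (s + t) (blinfun_apply Q (s + t))) ` \<Phi>"
      then obtain t where t: "t \<in> \<Phi>" "y = (norm (blinfun_apply Q s - - blinfun_apply Q t))\<^sup>2"
        unfolding form by blast
      have "- blinfun_apply Q t \<in> span E0" using t(1) \<Phi> by (intro span_neg) blast
      from onb_residual_minimal[OF E0 this, of "blinfun_apply Q s"]
      show "(norm (resid s))\<^sup>2 \<le> y"
        unfolding t(2) resid_def by (rule power_mono) simp
    qed
    then show ?thesis by simp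
  qed
  then have "is_short Q \<Phi> T"
    using T by (simp add: is_short_def apply_resid)
  then have "short Q \<Phi> = T"
    unfolding short_def by (intro the_equality is_short_unique[of Q \<Phi> _ T])
  then show ?thesis by (simp add: T(2) apply_resid)
qed

text \<open>The coefficient at a basis vector is the functional which that vector represents, a
  combination of observed ones.\<close>

lemma onb_proj_in_recovery_maps:
  assumes "E0 \<subseteq> blinfun_apply Q ` span G"
  shows "onb_proj E0 \<in> recovery_maps G"
proof -
  have "(\<lambda>x. inner x v) \<in> borel_measurable (sigma UNIV {blinfun_apply f -` A | f A. f \<in> G \<and> A \<in> sets borel})"
    if v: "v \<in> E0" for v
  proof -
    obtain f where f: "f \<in> span G" "v = blinfun_apply Q f" using assms v by blast
    then have "(\<lambda>x. inner x v) = blinfun_apply f" by (auto simp: riesz[of f] inner_commute)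
    then show ?thesis using functional_recovery_measurable[OF f(1)] by simp
  qed
  then show ?thesis
    unfolding recovery_maps_def onb_proj_def
    by (intro borel_measurable_sum borel_measurable_scaleR borel_measurable_const)
qed

text \<open>All observed functionals vanish on the support of \<open>gauss_on E\<close>, so a recovery map is the
  constant \<open>v 0\<close> there, and the mean of the centred law is the best constant.\<close>

lemma gauss_on_recovery_error:
  assumes E: "admissible E" and G: "blinfun_apply Q ` G \<subseteq> span E0" and v: "v \<in> recovery_maps G"
  shows "(\<integral>\<^sup>+x. ennreal ((norm (x - v x))\<^sup>2) \<partial>gauss_on E) = ennreal (real (card E) + (norm (v 0))\<^sup>2)"
proof -
  have "AE x in gauss_on E. \<forall>u\<in>E0. inner x u = 0"
    unfolding gauss_on_def using E E0(1)
    by (subst AE_distr_iff) (auto simp: noise_sum_def inner_sum_left admissible_def)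
  then have "AE x in gauss_on E. v x = v 0"
  proof (rule AE_mp, intro AE_I2 impI)
    fix x assume x: "\<forall>u\<in>E0. inner x u = 0"
    show "v x = v 0"
    proof (rule recovery_maps_eq_at_zero[OF v])
      fix f assume "f \<in> G"
      then have "blinfun_apply Q f \<in> span E0" using G by blast
      then have "inner x (blinfun_apply Q f) = 0"
        by (induction rule: span_induct_alt) (use x in \<open>auto simp: inner_add_right\<close>)
      then show "blinfun_apply f x = 0" by (simp add: riesz[of f] inner_commute)
    qed
  qed
  then have "(\<integral>\<^sup>+x. ennreal ((norm (x - v x))\<^sup>2) \<partial>gauss_on E) =
      (\<integral>\<^sup>+x. ennreal ((norm (x - v 0))\<^sup>2) \<partial>gauss_on E)"
    by (intro nn_integral_cong_AE) auto
  then show ?thesis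
    using E gauss_on_second_moment[of E "v 0"] by (simp add: admissible_def)
qed

text \<open>The excess over 1 is the cost of guessing a constant other than the mean; it vanishes
  exactly when \<open>v 0 = 0\<close>, as for the projection.\<close>

lemma Psi_gauss_on:
  assumes "admissible E" "E \<noteq> {}" "blinfun_apply Q ` G \<subseteq> span E0" "v \<in> recovery_maps G"
  shows "Psi v (gauss_on E) = ereal (1 + (norm (v 0))\<^sup>2 / real (card E))"
proof -
  have E: "finite E" "orthonormal E" using assms by (auto simp: admissible_def)
  then have c: "real (card E) > 0" using assms(2) by (simp add: card_gt_0_iff)
  have "Psi v (gauss_on E) =
      enn2ereal (ennreal (real (card E) + (norm (v 0))\<^sup>2) / ennreal (real (card E)))"
    unfolding Psi_def using gauss_on_recovery_error[OF assms(1,3,4)] gauss_on_second_moment[OF E, of 0] by simp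
  also have "\<dots> = ereal ((real (card E) + (norm (v 0))\<^sup>2) / real (card E))"
    using c by (subst divide_ennreal) auto
  finally show ?thesis using c by (simp add: add_divide_distrib)
qed

lemma eps_saddle_point_gauss_on:
  assumes E: "admissible E" "E \<noteq> {}" and G: "blinfun_apply Q ` G \<subseteq> span E0" "E0 \<subseteq> blinfun_apply Q ` span G"
    and \<epsilon>: "0 \<le> \<epsilon>"
  shows "eps_saddle_point G \<epsilon> (onb_proj E0) (gauss_on E)"
proof -
  note P = onb_proj_in_recovery_maps[OF G(2)]
  have "onb_proj E0 0 = 0" by (simp add: onb_proj_def)
  then have one: "Psi (onb_proj E0) (gauss_on E) = 1"
    using Psi_gauss_on[OF E G(1) P] by (simp add: one_ereal_def)
  have "Psi (onb_proj E0) \<mu> - ereal \<epsilon> \<le> 1" if "\<mu> \<in> M2" for \<mu>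
  proof -
    have "Psi (onb_proj E0) \<mu> \<le> 1"
      using onb_residual_minimal[OF E0 span_zero] by (intro Psi_le_one that) simp
    then show ?thesis using \<epsilon> by (cases "Psi (onb_proj E0) \<mu>") (auto simp: one_ereal_def)
  qed
  moreover have "1 \<le> Psi v (gauss_on E) + ereal \<epsilon>" if "v \<in> recovery_maps G" for v
    using \<epsilon> by (simp add: Psi_gauss_on[OF E G(1) that] one_ereal_def)
  moreover have "gauss_on E \<in> M2"
    using E by (intro gauss_on_in_M2) (auto simp: admissible_def)
  ultimately show ?thesis
    using P by (simp add: eps_saddle_point_def one)
qed

end

theorem theorem5p15:
  fixes Q :: "'a::{real_inner, polish_space} dual \<Rightarrow>\<^sub>L 'a"
    and \<phi> :: "nat \<Rightarrow> 'a dual" and m :: nat and \<Phi> :: "'a dual set"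
  assumes Q_bij: "bij (blinfun_apply Q)"
    and Q_sym: "symmetric_op Q"
    and Q_pos: "positive_op Q"
    and inner_Q: "\<And>u1 u2. inner u1 u2 = blinfun_apply (inv (blinfun_apply Q) u1) u2"
    and \<phi>_inj: "inj_on \<phi> {1..m}"
    and \<phi>_indep: "independent (\<phi> ` {1..m})"
    and \<Phi>_def: "\<Phi> = span (\<phi> ` {1..m})"
    and dim_less: "\<not> finite_dim (UNIV :: 'a set) \<or> dim \<Phi> < dim (UNIV :: 'a set)"
  shows "saddle_point (\<phi> ` {1..m}) (orth_proj (blinfun_apply Q ` \<Phi>))
           (gaussian_cylinder_measure (short Q \<Phi>)) \<and>
         (\<not> finite_dim (UNIV :: 'a set) \<longrightarrow>
           (\<exists>\<mu>s. approximating_sequence (\<phi> ` {1..m}) (orth_proj (blinfun_apply Q ` \<Phi>))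
                   (gaussian_cylinder_measure (short Q \<Phi>)) \<mu>s \<and>
                 (\<forall>n\<ge>1. gaussian_measure (\<mu>s n))))"
proof -
  let ?G = "\<phi> ` {1..m}"
  have Q\<Phi>: "blinfun_apply Q ` \<Phi> = span (blinfun_apply Q ` ?G)"
    unfolding \<Phi>_def
    by (rule linear_span_image[symmetric]) (intro bounded_linear.linear blinfun.bounded_linear_right)
  have "finite (blinfun_apply Q ` ?G)" by simp
  then obtain E0 where B: "finite E0" "orthonormal E0" "span E0 = blinfun_apply Q ` \<Phi>"
    using orthonormal_extend[of "blinfun_apply Q ` ?G" "{}"] Q\<Phi> by (auto simp: orthonormal_def)
  interpret gaussian_residual Q E0
  proof
    \<comment> \<open>Taking \<open>u1 = Q f\<close> in \<open>inner_Q\<close> cancels the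
      inverse.\<close>
    show "blinfun_apply f x = inner (blinfun_apply Q f) x" for f x
      using Q_bij by (simp add: inner_Q bij_is_inj)
  qed (use B in auto)
  have G: "blinfun_apply Q ` ?G \<subseteq> span E0" "E0 \<subseteq> blinfun_apply Q ` span ?G"
    using span_superset[of "blinfun_apply Q ` ?G"] span_superset[of E0] B(3) Q\<Phi> \<Phi>_def by auto
  \<comment> \<open>If \<open>Q \<Phi>\<close> were everything, both alternatives of
    \<open>dim_less\<close> would fail: the space would be finite-dimensional, of dimension at most
    that of \<Phi>.\<close>
  have proper: "span E0 \<noteq> UNIV"
  proof
    assume "span E0 = UNIV"
    then have U: "UNIV = span (blinfun_apply Q ` ?G)" using B(3) Q\<Phi> by simp
    then have "finite_dim (UNIV :: 'a set)" unfolding finite_dim_def by (intro exI[of _ "blinfun_apply Q ` ?G"]) simp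
    moreover have "dim (UNIV :: 'a set) \<le> card (blinfun_apply Q ` ?G)"
      using U by (intro dim_le_card) auto
    then have "dim (UNIV :: 'a set) \<le> card ?G"
      using card_image_le[of ?G "blinfun_apply Q"] by simp
    moreover have "dim \<Phi> = card ?G"
      unfolding \<Phi>_def using dim_span_eq_card_independent[OF \<phi>_indep] .
    ultimately show False using dim_less by simp
  qed
  then obtain x where x: "x \<notin> span E0" by auto
  \<comment> \<open>A nonzero vector of the complement, the seed that makes all \<open>E n\<close>
    nonempty.\<close>
  define w where "w = x - onb_proj E0 x"
  have w: "w \<noteq> 0" "\<And>u. u \<in> E0 \<Longrightarrow> inner w u = 0"
    using x onb_proj_in_span[of E0 x] inner_residual_span[OF B(1,2) span_base] by (auto simp: w_def)
  obtain E where E: "\<And>n. admissible (E n)" "\<And>n. E n \<noteq> {}"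
    "\<And>y. (\<And>u. u \<in> E0 \<Longrightarrow> inner y u = 0) \<Longrightarrow> (\<lambda>n. norm (y - onb_proj (E n) y)) \<longlonglongrightarrow> 0"
    using dense_admissible_sequence[OF w] by blast
  have P: "orth_proj (blinfun_apply Q ` \<Phi>) = onb_proj E0"
    using orth_proj_span[OF B(1,2)] B(3) by simp
  have law: "gaussian_cylinder_measure (short Q \<Phi>) = residual_law"
    by (intro gaussian_cylinder_measure_eq_residual_law short_quadratic_form) (simp add: B(3))
  have approx: "approximating_sequence ?G (onb_proj E0) residual_law (\<lambda>n. gauss_on (E n))"
    unfolding approximating_sequence_def
    using cylinder_converges_gauss_on[OF E(1,3)] eps_saddle_point_gauss_on[OF E(1,2) G]
    by (auto simp: eps_saddle_point_def)
  moreover have "gaussian_measure (gauss_on (E n))" for n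
    using E(1)[of n] by (intro gaussian_measure_gauss_on) (simp add: admissible_def)
  ultimately show ?thesis
    unfolding P law saddle_point_def
    using onb_proj_in_recovery_maps[OF G(2)] residual_law_in_CM by blast
qed

end
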